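(* Let $\lambda=(\lambda_L,\lambda_R)\in\mathbb{R}_+^2$, let $\eta=\sum_{i=1}^{\mathbf N}\delta_{x_i}$ be a finite point configuration on $(0,1)$, and let $\{\eta_t,\ t\ge 0\}$ be the boundary driven Brownian gas on $(0,1)$ with parameters $\lambda_L,\lambda_R$ started from $\eta$. Let $m$ be the Lebesgue measure on $(0,1)$. Then for every $n\in\mathbb{N}$ and $t>0$, the $n$-th factorial moment measure $\mathbb{E}^\lambda_\eta[\eta_t^{(n)}]$ is absolutely continuous with respect to $m^{\otimes n}$, with density $$\frac{\mathrm{d}\mathbb{E}^{\lambda}_\eta[\eta_t^{(n)}]}{\mathrm{d}m^{\otimes n}}(\boldsymbol z)=\sum_{I\subset[n]}\mathbb{E}^{\mathrm{abs}}_{\boldsymbol z_I}\left[\lambda_L^{\xi_t(\{0\})}\lambda_R^{\xi_t(\{1\})}\mathbf 1_{\{\xi_t(\{0,1\})=|I|\}}\right]\int_{(0,1)^{n-|I|}}\mathfrak p_t^{(n-|I|)}(\boldsymbol z_{[n]\setminus I},\boldsymbol y)\,\eta^{(n-|I|)}(\mathrm{d}\boldsymbol y).$$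
   Context: **Absorbed Brownian motion.** $\{W_t\}$ is standard Brownian motion on $[0,1]$ absorbed upon hitting $0$ or $1$; $\mathbb{P}^{\mathrm{abs}}_x$ is its law started from $x$, and $\tau_0,\tau_1$ are its hitting times of $0$ and $1$. For $t>0$ its transition probability satisfies $p_t(x,\mathrm{d}y)=\mathfrak p_t(x,y)\,\mathrm{d}y$ for $x,y\in(0,1)$, with $\mathfrak p_t(x,y)=\mathfrak p_t(y,x)$. Write $\mathfrak p^{(n)}_t(\boldsymbol x,\boldsymbol y)=\prod_{i=1}^n\mathfrak p_t(x_i,y_i)$. **Absorbed particle system.** For $\boldsymbol x=(x_1,\dots,x_k)\in(0,1)^k$, $\mathbb{E}^{\mathrm{abs}}_{\boldsymbol x}$ is the expectation for the point-configuration-valued process $\xi_t=\sum_{i=1}^k\delta_{W_t(i)}$ on $[0,1]$, where $W(1),\dots,W(k)$ are independent copies of $W$ with $W_0(i)=x_i$. **Boundary driven Brownian gas.** Started from $\eta=\sum_{i=1}^{\mathbf N}\delta_{x_i}$ with $x_i\in(0,1)$, it is defined for $t>0$ by $\eta_t=\xi_t|_{(0,1)}+\Theta_t$ (and $\eta_0=\eta$). Here $\xi_t$ is the absorbed particle system started from $\xi_0=\eta$, $\xi_t|_{(0,1)}$ is its restriction to $(0,1)$, and $\Theta_t$, independent of $\xi_t$, is a Poisson point process on $(0,1)$ with intensity measure $\lambda(t,x)\,\mathrm{d}x$, where $\lambda(t,x)=\lambda_L\mathbb{P}^{\mathrm{abs}}_x(\tau_0\le t)+\lambda_R\mathbb{P}^{\mathrm{abs}}_x(\tau_1\le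 t)$. $\mathbb{E}^\lambda_\eta$ denotes expectation for this process started from $\eta$. **Factorial measures.** For a finite configuration $\eta=\sum_{i=1}^{\mathbf N}\delta_{x_i}$, $\eta^{(n)}=\sum^{\ne}_{1\le i_1,\dots,i_n\le\mathbf N}\delta_{(x_{i_1},\dots,x_{i_n})}$, the sum being over $n$-tuples of mutually distinct indices. $\eta_t^{(n)}$ is the $n$-th factorial measure of $\eta_t$. **Notation.** $[n]=\{1,\dots,n\}$. For $I=\{i_1<\dots<i_k\}\subset[n]$, $\boldsymbol z_I=(z_{i_1},\dots,z_{i_k})$. Conventions: for $I=\emptyset$ the expectation equals $1$; for $I=[n]$ the integral equals $1$; $0^0=1$. *)

theory Defs
  imports "HOL-Probability.Probability" "HOL-Combinatorics.List_Permutation"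
begin

section \<open>Absorbed Brownian motion\<close>

text \<open>Continuous paths \<open>[0,\<infinity>) \<rightarrow> \<real>\<close> with the sigma-algebra generated by the coordinates;
  as for every product space \<open>PiM\<close>, a path takes the value \<open>undefined\<close> off its index set.\<close>

definition path_space :: "(real \<Rightarrow> real) measure" where
  "path_space = restrict_space (PiM {0..} (\<lambda>_. borel)) {w. continuous_on {0..} w}"

text \<open>The infimum is taken in \<open>ereal\<close>, so a set that is never hit has hitting time \<open>\<infinity>\<close>.\<close>

definition hitting_time :: "real set \<Rightarrow> (real \<Rightarrow> real) \<Rightarrow> ereal" where
  "hitting_time A w = (INF s\<in>{s. 0 \<le> s \<and> w s \<in> A}. ereal s)"

text \<open>\<open>V\<close> is the law of standard Brownian motion on the line, started from \<open>0\<close>.\<close>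

definition wiener_measure :: "(real \<Rightarrow> real) measure \<Rightarrow> bool" where
  "wiener_measure V \<longleftrightarrow>
     prob_space V \<and> sets V = sets path_space \<and>
     (AE w in V. w 0 = 0) \<and>
     (\<forall>s t. 0 \<le> s \<longrightarrow> s < t \<longrightarrow>
        distributed V lborel (\<lambda>w. w t - w s) (\<lambda>u. ennreal (normal_density 0 (sqrt (t - s)) u))) \<and>
     (\<forall>(n::nat) (s::nat \<Rightarrow> real). 0 \<le> s 0 \<longrightarrow> (\<forall>i<n. s i < s (Suc i)) \<longrightarrow>
        prob_space.indep_vars V (\<lambda>_. borel) (\<lambda>i w. w (s (Suc i)) - w (s i)) {..<n})"

definition absorb :: "(real \<Rightarrow> real) \<Rightarrow> real \<Rightarrow> real" where
  "absorb w = (\<lambda>t\<in>{0..}. w (real_of_ereal (min (ereal t) (hitting_time {0, 1} w))))"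

text \<open>The law of absorbed Brownian motion started from \<open>x\<close>, as a measure on path space.\<close>

definition abs_law :: "(real \<Rightarrow> real) measure \<Rightarrow> real \<Rightarrow> (real \<Rightarrow> real) measure" where
  "abs_law V x = distr V path_space (\<lambda>w. absorb (\<lambda>s. x + w s))"

definition transition_prob :: "(real \<Rightarrow> real) measure \<Rightarrow> real \<Rightarrow> real \<Rightarrow> real measure" where
  "transition_prob V t x = distr (abs_law V x) borel (\<lambda>w. w t)"

text \<open>\<open>p\<close> is a symmetric version of the transition density on the open interval.\<close>

definition transition_density ::
    "(real \<Rightarrow> real) measure \<Rightarrow> (real \<Rightarrow> real \<Rightarrow> real \<Rightarrow> real) \<Rightarrow> bool" where
  "transition_density V p \<longleftrightarrow>
     (\<forall>t>0.
       (\<forall>x\<in>{0<..<1}.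
          p t x \<in> borel_measurable (restrict_space borel {0<..<1}) \<and>
          (\<forall>y\<in>{0<..<1}. 0 \<le> p t x y) \<and>
          (\<forall>A\<in>sets borel. A \<subseteq> {0<..<1} \<longrightarrow>
             emeasure (transition_prob V t x) A = (\<integral>\<^sup>+y\<in>A. ennreal (p t x y) \<partial>lborel))) \<and>
       (\<forall>x\<in>{0<..<1}. \<forall>y\<in>{0<..<1}. p t x y = p t y x))"

section \<open>Point configurations\<close>

text \<open>A finite point configuration is a multiset of points; \<open>num_points \<eta> A\<close> is \<open>\<eta>(A)\<close>.\<close>

definition num_points :: "real multiset \<Rightarrow> real set \<Rightarrow> nat" where
  "num_points \<eta> A = size (filter_mset (\<lambda>x. x \<in> A) \<eta>)"

definition config_of :: "nat \<Rightarrow> (nat \<Rightarrow> real) \<Rightarrow> real multiset" where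
  "config_of N x = image_mset x (mset_set {1..N})"

definition config_space :: "real multiset measure" where
  "config_space = sigma UNIV {{\<eta>. num_points \<eta> A = k} | A k. A \<in> sets borel}"

definition unit_lebesgue :: "real measure" where
  "unit_lebesgue = restrict_space lborel {0<..<1}"

text \<open>The measure \<open>\<Sum> \<delta>\<close> over tuples of distinct indices is the image of the counting measure on
  injections of the positions \<open>{1..n}\<close> into the indices of an enumeration of \<open>\<eta>\<close>. The
  enumeration is immaterial, as \<open>factorial_measure_mset\<close> shows. The measure lives on \<open>(0,1)\<^sup>n\<close>, so \<open>\<eta>\<close> is meant to be
  a configuration on \<open>(0,1)\<close>.\<close>

definition factorial_measure_list :: "nat \<Rightarrow> real list \<Rightarrow> (nat \<Rightarrow> real) measure" where
  "factorial_measure_list n xs =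
     distr (count_space {i \<in> {1..n} \<rightarrow>\<^sub>E {..<length xs}. inj_on i {1..n}})
       (PiM {1..n} (\<lambda>_. unit_lebesgue)) (\<lambda>i. \<lambda>j\<in>{1..n}. xs ! i j)"

definition factorial_measure :: "nat \<Rightarrow> real multiset \<Rightarrow> (nat \<Rightarrow> real) measure" where
  "factorial_measure n \<eta> = factorial_measure_list n (SOME xs. mset xs = \<eta>)"

lemma factorial_measure_list_cong:
  assumes "mset xs = mset ys"
  shows "factorial_measure_list n xs = factorial_measure_list n ys"
proof -
  let ?I = "\<lambda>zs :: real list. {i \<in> {1..n} \<rightarrow>\<^sub>E {..<length zs}. inj_on i {1..n}}"
  obtain q where q: "q permutes {..<length ys}" and xs: "permute_list q ys = xs"
    using assms mset_eq_permutation by metis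
  have len: "length xs = length ys"
    using assms by (metis size_mset)
  have nth: "xs ! a = ys ! q a" if "a < length ys" for a
    using permute_list_nth[OF q that] xs by simp
  define g where "g = (\<lambda>i. \<lambda>j\<in>{1..n}. q (i j))"
  define h where "h = (\<lambda>i. \<lambda>j\<in>{1..n}. inv q (i j))"
  have q': "inv q permutes {..<length ys}"
    using q by (rule permutes_inv)
  have mem: "(\<lambda>j\<in>{1..n}. r (i j)) \<in> ?I ys"
    if r: "r permutes {..<length ys}" and i: "i \<in> ?I ys" for r i
  proof -
    have "inj_on (\<lambda>j. r (i j)) {1..n}"
      using comp_inj_on[of i "{1..n}" r] i inj_on_subset[OF permutes_inj[OF r] subset_UNIV]
      by (simp add: comp_def)
    then have "inj_on (\<lambda>j\<in>{1..n}. r (i j)) {1..n}"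
      by (rule inj_on_cong[THEN iffD2, rotated]) simp
    moreover have "r (i j) \<in> {..<length ys}" if "j \<in> {1..n}" for j
      using permutes_in_image[OF r, of "i j"] PiE_mem[of i "{1..n}" "\<lambda>_. {..<length ys}" j] i that
      by simp
    ultimately show ?thesis
      by (simp add: restrict_PiE_iff)
  qed
  have bij: "bij_betw g (?I ys) (?I ys)"
  proof (rule bij_betwI[where g = h])
    show "g \<in> ?I ys \<rightarrow> ?I ys"
      using mem[OF q] unfolding g_def by blast
    show "h \<in> ?I ys \<rightarrow> ?I ys"
      using mem[OF q'] unfolding h_def by blast
    show "h (g i) = i" if "i \<in> ?I ys" for i
    proof (rule PiE_ext[of _ "{1..n}" "\<lambda>_. {..<length ys}"])
      show "h (g i) \<in> {1..n} \<rightarrow>\<^sub>E {..<length ys}" "i \<in> {1..n} \<rightarrow>\<^sub>E {..<length ys}"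
        using that mem[OF q' mem[OF q that]] unfolding g_def h_def by blast+
    qed (simp add: g_def h_def permutes_inverses[OF q])
    show "g (h i) = i" if "i \<in> ?I ys" for i
    proof (rule PiE_ext[of _ "{1..n}" "\<lambda>_. {..<length ys}"])
      show "g (h i) \<in> {1..n} \<rightarrow>\<^sub>E {..<length ys}" "i \<in> {1..n} \<rightarrow>\<^sub>E {..<length ys}"
        using that mem[OF q mem[OF q' that]] unfolding g_def h_def by blast+
    qed (simp add: g_def h_def permutes_inverses[OF q])
  qed
  let ?f = "\<lambda>zs :: real list. \<lambda>i. \<lambda>j\<in>{1..n}. zs ! i j"
  have fg: "?f xs i = ?f ys (g i)" if "i \<in> ?I ys" for i
  proof (rule restrict_ext)
    fix j assume j: "j \<in> {1..n}"
    then have "i j < length ys"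
      using PiE_mem[of i "{1..n}" "\<lambda>_. {..<length ys}" j] that by simp
    then show "xs ! i j = ys ! g i j"
      using j nth by (simp add: g_def)
  qed
  have em: "emeasure (count_space (?I ys)) (?f xs -` A \<inter> ?I ys) =
      emeasure (count_space (?I ys)) (?f ys -` A \<inter> ?I ys)" for A
  proof -
    have "?f ys -` A \<inter> ?I ys = {k \<in> g ` ?I ys. ?f ys k \<in> A}"
      using bij_betw_imp_surj_on[OF bij] by blast
    also have "\<dots> = g ` {k \<in> ?I ys. ?f ys (g k) \<in> A}"
      by blast
    also have "{k \<in> ?I ys. ?f ys (g k) \<in> A} = ?f xs -` A \<inter> ?I ys"
      using fg by (simp add: set_eq_iff) metis
    finally have "card (?f ys -` A \<inter> ?I ys) = card (?f xs -` A \<inter> ?I ys)"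
      by (simp only: card_image[OF inj_on_subset[OF bij_betw_imp_inj_on[OF bij] Int_lower2]])
    moreover have fin: "finite (?I ys)"
      by (rule finite_subset[OF _ finite_PiE[of "{1..n}" "\<lambda>_. {..<length ys}"]]) auto
    ultimately show ?thesis
      by (simp only: emeasure_count_space_finite[OF Int_lower2 finite_subset[OF Int_lower2 fin]])
  qed
  show ?thesis
    unfolding factorial_measure_list_def distr_def len space_count_space by (simp only: em)
qed

lemma factorial_measure_mset: "factorial_measure n (mset xs) = factorial_measure_list n xs"
  unfolding factorial_measure_def
  by (rule factorial_measure_list_cong, rule someI[of _ xs]) (rule refl)

definition factorial_moment_measure ::
    "'w measure \<Rightarrow> nat \<Rightarrow> ('w \<Rightarrow> real multiset) \<Rightarrow> (nat \<Rightarrow> real) measure" where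
  "factorial_moment_measure P n X =
     measure_of (space (PiM {1..n} (\<lambda>_. unit_lebesgue))) (sets (PiM {1..n} (\<lambda>_. unit_lebesgue)))
       (\<lambda>A. \<integral>\<^sup>+\<omega>. emeasure (factorial_measure n (X \<omega>)) A \<partial>P)"

text \<open>Poisson point process with a finite intensity measure \<open>\<mu>\<close>, which makes a process with values
  in the finite configurations on \<open>space \<mu>\<close> appropriate.\<close>

definition poisson_point_process ::
    "'w measure \<Rightarrow> real measure \<Rightarrow> ('w \<Rightarrow> real multiset) \<Rightarrow> bool" where
  "poisson_point_process P \<mu> \<Theta> \<longleftrightarrow>
     finite_measure \<mu> \<and> \<Theta> \<in> measurable P config_space \<and>
     (\<forall>\<omega>\<in>space P. set_mset (\<Theta> \<omega>) \<subseteq> space \<mu>) \<and>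
     (\<forall>A\<in>sets \<mu>. \<forall>k. measure P {\<omega>\<in>space P. num_points (\<Theta> \<omega>) A = k}
        = measure \<mu> A ^ k / fact k * exp (- measure \<mu> A)) \<and>
     (\<forall>(n::nat) A. (\<forall>i<n. A i \<in> sets \<mu>) \<longrightarrow> disjoint_family_on A {..<n} \<longrightarrow>
        prob_space.indep_vars P (\<lambda>_. count_space UNIV) (\<lambda>i \<omega>. num_points (\<Theta> \<omega>) (A i)) {..<n})"

section \<open>Absorbed particle system and boundary driven Brownian gas\<close>

definition particle_config :: "nat \<Rightarrow> (nat \<Rightarrow> real \<Rightarrow> real) \<Rightarrow> real \<Rightarrow> real multiset" where
  "particle_config k w t = config_of k (\<lambda>i. w i t)"

text \<open>\<open>F\<close> is a functional of the configuration-valued trajectory \<open>\<xi>\<close>.\<close>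

definition abs_expectation ::
    "(real \<Rightarrow> real) measure \<Rightarrow> nat \<Rightarrow> (nat \<Rightarrow> real) \<Rightarrow> ((real \<Rightarrow> real multiset) \<Rightarrow> real) \<Rightarrow> real" where
  "abs_expectation V k x F = (\<integral>w. F (particle_config k w) \<partial>PiM {1..k} (\<lambda>i. abs_law V (x i)))"

definition gas_intensity :: "(real \<Rightarrow> real) measure \<Rightarrow> real \<Rightarrow> real \<Rightarrow> real \<Rightarrow> real \<Rightarrow> real" where
  "gas_intensity V lam\<^sub>L lam\<^sub>R t x =
     lam\<^sub>L * measure (abs_law V x) {w \<in> space path_space. hitting_time {0} w \<le> ereal t} +
     lam\<^sub>R * measure (abs_law V x) {w \<in> space path_space. hitting_time {1} w \<le> ereal t}"

definition boundary_driven_gas ::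
    "(real \<Rightarrow> real) measure \<Rightarrow> real \<Rightarrow> real \<Rightarrow> nat \<Rightarrow> (nat \<Rightarrow> real) \<Rightarrow> 'w measure
      \<Rightarrow> (real \<Rightarrow> 'w \<Rightarrow> real multiset) \<Rightarrow> bool" where
  "boundary_driven_gas V lam\<^sub>L lam\<^sub>R N x P H \<longleftrightarrow>
     prob_space P \<and>
     (\<forall>\<omega>\<in>space P. H 0 \<omega> = config_of N x) \<and>
     (\<exists>(W :: nat \<Rightarrow> 'w \<Rightarrow> real \<Rightarrow> real) (\<Theta> :: real \<Rightarrow> 'w \<Rightarrow> real multiset).
        prob_space.indep_vars P (\<lambda>_. path_space) W {1..N} \<and>
        (\<forall>i\<in>{1..N}. distr P path_space (W i) = abs_law V (x i)) \<and>
        (\<forall>t>0.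
           poisson_point_process P
             (density unit_lebesgue (\<lambda>x. ennreal (gas_intensity V lam\<^sub>L lam\<^sub>R t x))) (\<Theta> t) \<and>
           prob_space.indep_var P
             config_space (\<lambda>\<omega>. particle_config N (\<lambda>i. W i \<omega>) t) config_space (\<Theta> t) \<and>
           (\<forall>\<omega>\<in>space P. H t \<omega> =
              filter_mset (\<lambda>u. u \<in> {0<..<1}) (particle_config N (\<lambda>i. W i \<omega>) t) + \<Theta> t \<omega>)))"

text \<open>\<open>subtuple z I = (z\<^bsub>i\<^sub>1\<^esub>, \<dots>, z\<^bsub>i\<^sub>k\<^esub>)\<close> for \<open>I = {i\<^sub>1 < \<dots> < i\<^sub>k}\<close>, reindexed by \<open>{1..k}\<close>.\<close>

definition subtuple :: "(nat \<Rightarrow> real) \<Rightarrow> nat set \<Rightarrow> nat \<Rightarrow> real" where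
  "subtuple z I = (\<lambda>j\<in>{1..card I}. z (sorted_list_of_set I ! (j - 1)))"

text \<open>With \<open>PiM {}\<close> a one-point probability space, the empty tuple contributes the factor \<open>1\<close>
  both in the expectation and in the integral; \<open>0 ^ 0 = 1\<close> holds in HOL.\<close>

definition moment_density ::
    "(real \<Rightarrow> real) measure \<Rightarrow> (real \<Rightarrow> real \<Rightarrow> real \<Rightarrow> real) \<Rightarrow> real \<Rightarrow> real \<Rightarrow> real multiset
      \<Rightarrow> real \<Rightarrow> nat \<Rightarrow> (nat \<Rightarrow> real) \<Rightarrow> real" where
  "moment_density V p lam\<^sub>L lam\<^sub>R \<eta> t n z =
     (\<Sum>I\<in>Pow {1..n}.
        abs_expectation V (card I) (subtuple z I)
          (\<lambda>\<xi>. lam\<^sub>L ^ num_points (\<xi> t) {0} * lam\<^sub>R ^ num_points (\<xi> t) {1}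
                * of_bool (num_points (\<xi> t) {0, 1} = card I)) *
        (\<integral>y. (\<Prod>j\<in>{1..n - card I}. p t (subtuple z ({1..n} - I) j) (y j))
           \<partial>factorial_measure (n - card I) \<eta>))"

end

theory Submission
  imports Defs
begin

text \<open>Split a tuple of distinct points of \<open>\<eta>\<^sub>t\<close> into the positions \<open>I\<close> filled by points of the Poisson
  process and those filled by points of \<open>\<xi>\<^sub>t\<close>. By independence the factorial moment measure is a sum over
  \<open>I\<close> of products of factorial moment measures of the two parts. The Poisson part has the product density
  \<open>\<lambda>(t, z)\<close>, which is the probability-weighted absorption \<open>\<lambda>\<^sub>L P\<^sub>z(W\<^sub>t = 0) + \<lambda>\<^sub>R P\<^sub>z(W\<^sub>t = 1)\<close>, since an
  absorbed path that has hit a boundary point by time \<open>t\<close> sits there at time \<open>t\<close>. The other part has density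
  \<open>p\<^sub>t(x\<^sub>i, z) = p\<^sub>t(z, x\<^sub>i)\<close> along each injection of positions into particles, which is integration
  against the factorial measure of \<open>\<eta>\<close>. It suffices to compare finite measures on rectangles.\<close>

section \<open>Sums over injections\<close>

text \<open>The hypotheses on the gas see configurations only through numbers of points: the Poisson
  property concerns counts in disjoint sets, and the independence of the two parts concerns the
  sigma-algebra generated by counts. The factorial measure, however, is built from an enumeration
  chosen by \<open>SOME\<close>, which carries no measurability. The proof therefore reads one
  algebraic object, a sum over injections of positions into a list, in two ways. As a function of a
  list it splits along concatenation, and along labelled particles it can use the independence of
  the paths. As a polynomial in counts of disjoint cells it is measurable and can be integrated
  against the Poisson law. Arbitrary finite sets of positions are allowed, so that the sorted
  renumbering in \<open>subtuple\<close> has to be undone only once, when the density is evaluated.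
  Rectangles determine the measures because the total mass is finite: the intensity measure is
  finite, and a single particle has mass at most 1.\<close>

definition injections :: "'j set \<Rightarrow> nat \<Rightarrow> ('j \<Rightarrow> nat) set" where
  "injections J m = {i \<in> J \<rightarrow>\<^sub>E {..<m}. inj_on i J}"

text \<open>This is the permanent of the rectangular matrix with entries \<open>f j x\<close>, rows
  indexed by positions and columns by list entries. The semiring is general because the density
  takes real values and the measures take \<open>ennreal\<close> values.\<close>

definition inj_sum :: "'j set \<Rightarrow> 'a list \<Rightarrow> ('j \<Rightarrow> 'a \<Rightarrow> 'b::comm_semiring_1) \<Rightarrow> 'b" where
  "inj_sum J xs f = (\<Sum>i\<in>injections J (length xs). \<Prod>j\<in>J. f j (xs ! i j))"

lemma injections_mem: "i \<in> injections J m \<Longrightarrow> j \<in> J \<Longrightarrow> i j < m"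
  by (auto simp: injections_def)

lemma finite_injections: "finite J \<Longrightarrow> finite (injections J m)"
  unfolding injections_def by (rule finite_subset[OF _ finite_PiE[of J "\<lambda>_. {..<m}"]]) auto

text \<open>Injectivity lets the new value \<open>m\<close> occur at most once: either it is missed,
  or exactly one position \<open>j\<close> takes it and the remaining positions inject into the old
  values.\<close>

lemma injections_Suc:
  "injections J (Suc m) =
     injections J m \<union> (\<Union>j\<in>J. (\<lambda>i. i(j := m)) ` injections (J - {j}) m)" (is "_ = ?R")
proof (intro equalityI subsetI)
  fix i assume i: "i \<in> injections J (Suc m)"
  show "i \<in> ?R"
  proof (cases "\<exists>j\<in>J. i j = m")
    case False
    then have "i j < m" if "j \<in> J" for j
      using injections_mem[OF i that] that by (auto simp: less_Suc_eq)
    then show ?thesis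
      using i by (auto simp: injections_def PiE_iff)
  next
    case True
    then obtain j where j: "j \<in> J" "i j = m" by blast
    have "i l < m" if "l \<in> J - {j}" for l
      using injections_mem[OF i, of l] that j i by (auto simp: injections_def inj_on_def less_Suc_eq)
    \<comment> \<open>The value \<open>undefined\<close> at \<open>j\<close> makes the reduced map
      extensional on \<open>J - {j}\<close>.\<close>
    then have "i(j := undefined) \<in> injections (J - {j}) m"
      using i j by (auto simp: injections_def PiE_iff extensional_def inj_on_def)
    moreover have "i = (i(j := undefined))(j := m)"
      using j by auto
    ultimately show ?thesis
      using j by blast
  qed
next
  fix i assume "i \<in> ?R"
  then consider "i \<in> injections J m"
    | j k where "j \<in> J" "k \<in> injections (J - {j}) m" "i = k(j := m)"
    by blast
  then show "i \<in> injections J (Suc m)"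
  proof cases
    case 1
    then show ?thesis
      by (auto simp: injections_def PiE_iff less_Suc_eq)
  next
    case 2
    have "k l < m" if "l \<in> J" "l \<noteq> j" for l
      using injections_mem[OF 2(2), of l] that by simp
    then show ?thesis
      using 2 by (force simp: injections_def PiE_iff extensional_def inj_on_def less_Suc_eq)
  qed
qed

lemma inj_sum_Nil: "inj_sum J [] f = (if J = {} then 1 else 0)"
  by (auto simp: inj_sum_def injections_def)

lemma inj_sum_empty [simp]: "inj_sum {} xs f = 1"
  by (simp add: inj_sum_def injections_def)

text \<open>Expansion of the permanent along its last column. A point added at the end leaves the
  indices of the older points unchanged, which is why the inductions on lists below run from the
  right.\<close>

lemma inj_sum_snoc:
  assumes J: "finite J"
  shows "inj_sum J (xs @ [x]) f =
    inj_sum J xs f + (\<Sum>j\<in>J. f j x * inj_sum (J - {j}) xs f)"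
proof -
  let ?m = "length xs"
  let ?g = "\<lambda>i. \<Prod>j\<in>J. f j ((xs @ [x]) ! i j)"
  let ?B = "\<lambda>j. (\<lambda>i. i(j := ?m)) ` injections (J - {j}) ?m"
  have fin: "finite (injections K ?m)" if "K \<subseteq> J" for K
    using finite_injections[OF finite_subset[OF that J]] .
  have neq: "k l \<noteq> ?m" if "k \<in> injections K ?m" "l \<in> K" for k K l
    using injections_mem[OF that] by simp
  have "inj_sum J (xs @ [x]) f = (\<Sum>i\<in>injections J ?m \<union> (\<Union>j\<in>J. ?B j). ?g i)"
    unfolding inj_sum_def by (simp add: injections_Suc)
  also have "\<dots> = (\<Sum>i\<in>injections J ?m. ?g i) + (\<Sum>i\<in>(\<Union>j\<in>J. ?B j). ?g i)"
  proof (rule sum.union_disjoint)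
    show "injections J ?m \<inter> (\<Union>j\<in>J. ?B j) = {}"
      using neq by fastforce
  qed (use J fin in auto)
  also have "(\<Sum>i\<in>(\<Union>j\<in>J. ?B j). ?g i) = (\<Sum>j\<in>J. \<Sum>i\<in>?B j. ?g i)"
  proof (rule sum.UNION_disjoint)
    show "\<forall>j\<in>J. \<forall>l\<in>J. j \<noteq> l \<longrightarrow> ?B j \<inter> ?B l = {}"
    proof (intro ballI impI)
      fix j l assume jl: "j \<in> J" "l \<in> J" "j \<noteq> l"
      have "i j = ?m" if "i \<in> ?B j" for i using that by auto
      moreover have "i j \<noteq> ?m" if "i \<in> ?B l" for i
        using that jl neq[of _ "J - {l}" j] by auto
      ultimately show "?B j \<inter> ?B l = {}" by blast
    qed
  qed (use J fin in auto)
  also have "\<dots> = (\<Sum>j\<in>J. f j x * inj_sum (J - {j}) xs f)"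
  proof (rule sum.cong[OF refl])
    fix j assume that: "j \<in> J"
    have "inj_on (\<lambda>i. i(j := ?m)) (injections (J - {j}) ?m)"
    proof (rule inj_onI)
      fix k l assume k: "k \<in> injections (J - {j}) ?m" "l \<in> injections (J - {j}) ?m"
        and eq: "k(j := ?m) = l(j := ?m)"
      show "k = l"
      proof
        fix a show "k a = l a"
          using k fun_cong[OF eq, of a] by (cases "a = j") (auto simp: injections_def PiE_iff extensional_def)
      qed
    qed
    then have "(\<Sum>i\<in>?B j. ?g i) = (\<Sum>i\<in>injections (J - {j}) ?m. ?g (i(j := ?m)))"
      by (subst sum.reindex) simp_all
    also have "\<dots> = (\<Sum>i\<in>injections (J - {j}) ?m. f j x * (\<Prod>l\<in>J - {j}. f l (xs ! i l)))"
    proof (rule sum.cong[OF refl])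
      fix i assume i: "i \<in> injections (J - {j}) ?m"
      have "(\<Prod>l\<in>J - {j}. f l ((xs @ [x]) ! (i(j := ?m)) l)) = (\<Prod>l\<in>J - {j}. f l (xs ! i l))"
        using injections_mem[OF i] by (intro prod.cong) (auto simp: nth_append)
      then show "?g (i(j := ?m)) = f j x * (\<Prod>l\<in>J - {j}. f l (xs ! i l))"
        by (subst prod.remove[OF J that]) simp
    qed
    finally show "(\<Sum>i\<in>?B j. ?g i) = f j x * inj_sum (J - {j}) xs f"
      by (simp add: inj_sum_def sum_distrib_left)
  qed
  also have "(\<Sum>i\<in>injections J ?m. ?g i) = inj_sum J xs f"
    unfolding inj_sum_def
    by (intro sum.cong prod.cong refl) (auto simp: nth_append dest: injections_mem)
  finally show ?thesis
    by simp
qed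

text \<open>A pair \<open>(j, I)\<close> with \<open>j\<close> outside \<open>I\<close> is the same
  as a set \<open>insert j I\<close> with a marked element \<open>j\<close>.\<close>

lemma sum_Pow_remove:
  assumes J: "finite J"
  shows "(\<Sum>j\<in>J. \<Sum>I\<in>Pow (J - {j}). h j I) = (\<Sum>I\<in>Pow J. \<Sum>j\<in>I. h j (I - {j}))"
proof -
  have "(\<Sum>(j, I)\<in>Sigma J (\<lambda>j. Pow (J - {j})). h j I) =
      (\<Sum>(I, j)\<in>Sigma (Pow J) (\<lambda>I. I). h j (I - {j}))"
    by (rule sum.reindex_bij_witness[where i = "\<lambda>(I, j). (j, I - {j})"
          and j = "\<lambda>(j, I). (insert j I, j)"])
       (auto intro: arg_cong2[where f=h])
  then show ?thesis
    using J by (simp add: sum.Sigma finite_subset[OF _ J])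
qed

lemma inj_sum_append:
  assumes "finite J"
  shows "inj_sum J (xs @ ys) f = (\<Sum>I\<in>Pow J. inj_sum I ys f * inj_sum (J - I) xs f)"
  using assms
proof (induction ys arbitrary: J rule: rev_induct)
  case Nil
  have "(\<Sum>I\<in>Pow J. inj_sum I [] f * inj_sum (J - I) xs f) =
      (\<Sum>I\<in>Pow J. if I = {} then inj_sum (J - I) xs f else 0)"
    by (intro sum.cong) (auto simp: inj_sum_Nil)
  also have "\<dots> = inj_sum J xs f"
    using Nil by (subst sum.delta) auto
  finally show ?case by simp
next
  case (snoc y ys)
  have "inj_sum J (xs @ ys @ [y]) f =
      inj_sum J (xs @ ys) f + (\<Sum>j\<in>J. f j y * inj_sum (J - {j}) (xs @ ys) f)"
    using inj_sum_snoc[OF snoc.prems, of "xs @ ys" y f] by simp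
  also have "\<dots> = (\<Sum>I\<in>Pow J. inj_sum I ys f * inj_sum (J - I) xs f) +
      (\<Sum>j\<in>J. \<Sum>I\<in>Pow (J - {j}). f j y * (inj_sum I ys f * inj_sum (J - {j} - I) xs f))"
    using snoc.prems by (simp add: snoc.IH sum_distrib_left)
  also have "(\<Sum>j\<in>J. \<Sum>I\<in>Pow (J - {j}). f j y * (inj_sum I ys f * inj_sum (J - {j} - I) xs f)) =
      (\<Sum>I\<in>Pow J. \<Sum>j\<in>I. f j y * (inj_sum (I - {j}) ys f * inj_sum (J - {j} - (I - {j})) xs f))"
    by (rule sum_Pow_remove[OF snoc.prems])
  also have "\<dots> = (\<Sum>I\<in>Pow J. (\<Sum>j\<in>I. f j y * inj_sum (I - {j}) ys f) * inj_sum (J - I) xs f)"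
    unfolding sum_distrib_right
    by (intro sum.cong refl) (auto simp: mult.assoc intro!: arg_cong2[where f="(*)"] arg_cong[where f="\<lambda>K. inj_sum K xs f"])
  also have "(\<Sum>I\<in>Pow J. inj_sum I ys f * inj_sum (J - I) xs f) + \<dots> =
      (\<Sum>I\<in>Pow J. inj_sum I (ys @ [y]) f * inj_sum (J - I) xs f)"
    unfolding sum.distrib[symmetric]
    by (intro sum.cong refl) (auto simp: inj_sum_snoc distrib_right finite_subset[OF _ snoc.prems])
  finally show ?case .
qed

text \<open>With induction on the list the bijection acts on rows only, and no bijection between two
  sets of extensional injections has to be written down.\<close>

lemma inj_sum_reindex:
  assumes "bij_betw h K J" and "finite K"
  shows "inj_sum K xs (\<lambda>j. f (h j)) = inj_sum J xs f"
  using assms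
proof (induction xs arbitrary: K J rule: rev_induct)
  case Nil
  then show ?case
    by (auto simp: inj_sum_Nil bij_betw_def)
next
  case (snoc x xs)
  have fin: "finite J"
    using snoc.prems bij_betw_finite by blast
  have "inj_sum (K - {j}) xs (\<lambda>j. f (h j)) = inj_sum (J - {h j}) xs f" if "j \<in> K" for j
    using snoc.prems that by (intro snoc.IH bij_betw_DiffI) (auto simp: bij_betw_def)
  then have "(\<Sum>j\<in>K. f (h j) x * inj_sum (K - {j}) xs (\<lambda>j. f (h j))) =
      (\<Sum>j\<in>K. (\<lambda>j. f j x * inj_sum (J - {j}) xs f) (h j))"
    by simp
  also have "\<dots> = (\<Sum>j\<in>J. f j x * inj_sum (J - {j}) xs f)"
    by (rule sum.reindex_bij_betw[OF snoc.prems(1)])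
  finally show ?case
    using snoc fin by (simp add: inj_sum_snoc)
qed

text \<open>A column of zeros contributes to no injection. This serves to put back the particles
  absorbed at the boundary, which the test sets do not see.\<close>

lemma inj_sum_filter:
  assumes "finite J" and "\<And>j x. j \<in> J \<Longrightarrow> \<not> Q x \<Longrightarrow> f j x = 0"
  shows "inj_sum J (filter Q xs) f = inj_sum J xs f"
  using assms
proof (induction xs arbitrary: J rule: rev_induct)
  case (snoc x xs)
  have "inj_sum (J - {j}) (filter Q xs) f = inj_sum (J - {j}) xs f" for j
    using snoc.prems by (intro snoc.IH) auto
  then show ?case
    using snoc.prems by (simp add: inj_sum_snoc snoc.IH)
qed simp

lemma inj_sum_cong:
  assumes "\<And>j x. j \<in> J \<Longrightarrow> x \<in> set xs \<Longrightarrow> f j x = g j x"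
  shows "inj_sum J xs f = inj_sum J xs g"
  unfolding inj_sum_def using assms
  by (intro sum.cong prod.cong refl) (auto dest: injections_mem)

lemma inj_sum_map: "inj_sum J (map h xs) f = inj_sum J xs (\<lambda>j x. f j (h x))"
  unfolding inj_sum_def by (auto intro!: sum.cong prod.cong arg_cong[where f="f _"] nth_map dest: injections_mem)

text \<open>Multilinearity of the permanent in its rows: \<open>c\<close> selects one summand for
  each row.\<close>

lemma inj_sum_sum:
  assumes "finite J" and "\<And>j. j \<in> J \<Longrightarrow> finite (S j)"
  shows "inj_sum J xs (\<lambda>j x. \<Sum>b\<in>S j. f b x) = (\<Sum>c\<in>PiE J S. inj_sum J xs (\<lambda>j. f (c j)))"
  unfolding inj_sum_def
  by (subst sum.swap) (simp add: prod_sum_PiE[OF assms])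

text \<open>\<open>fact k * (n choose k)\<close> is a falling factorial of \<open>n\<close>, and
  this is its recursion in \<open>n\<close>. At \<open>k = 0\<close> the truncated
  \<open>k - 1\<close> is harmless, since its term carries the factor \<open>k\<close>.\<close>

lemma fact_mult_Suc_choose:
  "fact k * (Suc n choose k) = fact k * (n choose k) + k * (fact (k - 1) * (n choose (k - 1)))"
  by (cases k) (simp_all add: algebra_simps)

text \<open>The positions assigned to cell \<open>b\<close> must receive distinct points of
  \<open>B b\<close>, which is possible in a falling factorial number of ways, and disjoint cells do
  not compete for points. One more point lies in at most one cell, so the induction changes a single
  factor.\<close>

lemma inj_sum_disjoint:
  assumes "finite J" and S: "finite S" "disjoint_family_on B S" and "\<And>j. j \<in> J \<Longrightarrow> c j \<in> S"
  shows "(inj_sum J xs (\<lambda>j. indicator (B (c j))) :: 'b::comm_semiring_1) =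
    (\<Prod>b\<in>S. of_nat (fact (card {j \<in> J. c j = b}) *
      (num_points (mset xs) (B b) choose card {j \<in> J. c j = b})))"
  using assms(1,4)
proof (induction xs arbitrary: J rule: rev_induct)
  case Nil
  show ?case
  proof (cases "J = {}")
    case True
    then show ?thesis by simp
  next
    case False
    then obtain j where j: "j \<in> J" by blast
    then have "card {l \<in> J. c l = c j} \<noteq> 0"
      using Nil by (subst card_0_eq) auto
    then have "(num_points {#} (B (c j)) choose card {l \<in> J. c l = c j}) = 0"
      by (simp add: num_points_def binomial_eq_0)
    then have "\<exists>b\<in>S. (of_nat (fact (card {j \<in> J. c j = b}) *
      (num_points (mset []) (B b) choose card {j \<in> J. c j = b})) :: 'b) = 0"
      using Nil(2)[OF j] by (intro bexI[of _ "c j"]) (simp_all only: mset.simps mult_0_right of_nat_0)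
    then show ?thesis
      using False S by (simp add: inj_sum_Nil prod_zero del: of_nat_mult)
  qed
next
  case (snoc x xs)
  let ?J = "\<lambda>J b. {j \<in> J. c j = b}"
  let ?F = "\<lambda>xs J b. of_nat (fact (card (?J J b)) * (num_points (mset xs) (B b) choose card (?J J b))) :: 'b"
  let ?f = "\<lambda>j. indicator (B (c j)) :: _ \<Rightarrow> 'b"
  have num: "num_points (mset (xs @ [x])) (B b) = num_points (mset xs) (B b) + of_bool (x \<in> B b)" for b
    by (simp add: num_points_def)
  have IH: "inj_sum J xs ?f = (\<Prod>b\<in>S. ?F xs J b)"
    by (rule snoc.IH[OF snoc.prems])
  have IH': "inj_sum (J - {j}) xs ?f = (\<Prod>b\<in>S. ?F xs (J - {j}) b)" for j
    using snoc.prems by (intro snoc.IH) auto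
  show ?case
  proof (cases "\<exists>a\<in>S. x \<in> B a")
    case False
    then have "?f j x = 0" if "j \<in> J" for j
      using snoc.prems(2)[OF that] by auto
    moreover have "num_points (mset (xs @ [x])) (B b) = num_points (mset xs) (B b)" if "b \<in> S" for b
      using False that num by auto
    ultimately show ?thesis
      using snoc.prems(1) by (simp add: inj_sum_snoc IH del: mset_append)
  next
    case True
    then obtain a where a: "a \<in> S" "x \<in> B a" by blast
    have only: "x \<in> B b \<longleftrightarrow> b = a" if "b \<in> S" for b
      using S(2) a that by (auto simp: disjoint_family_on_def)
    define R where "R = (\<Prod>b\<in>S - {a}. ?F xs J b)"
    have split: "(\<Prod>b\<in>S. G b) = G a * (\<Prod>b\<in>S - {a}. G b)" for G :: "_ \<Rightarrow> 'b"
      by (rule prod.remove[OF S(1) a(1)])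
    \<comment> \<open>Only a position assigned to the cell of \<open>x\<close> can receive
      \<open>x\<close>, and all such positions give the same term.\<close>
    have summand: "?f j x * inj_sum (J - {j}) xs ?f = (if j \<in> ?J J a then
        of_nat (fact (card (?J J a) - 1) * (num_points (mset xs) (B a) choose (card (?J J a) - 1))) * R else 0)"
      if j: "j \<in> J" for j
    proof (cases "c j = a")
      case True
      have "?J (J - {j}) a = ?J J a - {j}" by auto
      then have card: "card (?J (J - {j}) a) = card (?J J a) - 1"
        using True j snoc.prems(1) by (simp add: card_Diff_singleton)
      have "?J (J - {j}) b = ?J J b" if "b \<in> S - {a}" for b
        using that True by auto
      then have "(\<Prod>b\<in>S - {a}. ?F xs (J - {j}) b) = R"
        unfolding R_def by (intro prod.cong) auto
      then show ?thesis
        using True j a card by (simp add: IH' split)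
    next
      case False
      then show ?thesis
        using j only[of "c j"] snoc.prems(2) by simp
    qed
    have "(\<Sum>j\<in>J. ?f j x * inj_sum (J - {j}) xs ?f) =
        of_nat (card (?J J a)) * (of_nat (fact (card (?J J a) - 1) *
          (num_points (mset xs) (B a) choose (card (?J J a) - 1))) * R)"
      using snoc.prems(1) by (simp only: summand sum.If_cases cong: sum.cong)
        (simp add: Int_def conj_commute)
    also have "inj_sum J xs ?f + \<dots> = ?F (xs @ [x]) J a * R"
      unfolding IH split[of "?F xs J"] R_def[symmetric] num using a
      by (simp only: of_bool_eq simp_thms add_0_right Suc_eq_plus1[symmetric] fact_mult_Suc_choose)
        (simp add: algebra_simps)
    also have "R = (\<Prod>b\<in>S - {a}. ?F (xs @ [x]) J b)"
      unfolding R_def using only by (intro prod.cong refl) (simp add: num del: mset_append)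
    finally show ?thesis
      using snoc.prems(1) by (simp only: inj_sum_snoc split)
  qed
qed

section \<open>Absorbed paths\<close>

lemma space_path_space: "space path_space = {w \<in> extensional {0..}. continuous_on {0..} w}"
  by (auto simp: path_space_def space_restrict_space space_PiM PiE_UNIV_domain PiE_def)

lemma measurable_path_component [measurable]:
  "0 \<le> t \<Longrightarrow> (\<lambda>w. w t) \<in> borel_measurable path_space"
  unfolding path_space_def by (intro measurable_restrict_space1 measurable_component_singleton) simp

text \<open>The times that a continuous path spends in a closed set form a closed set bounded below,
  so if there are any, there is a first one.\<close>

lemma hitting_time_cases:
  assumes w: "continuous_on {0..} w" and A: "closed A"
  obtains (never) "\<forall>s\<ge>0. w s \<notin> A" "hitting_time A w = \<infinity>"
    | (hits) m where "0 \<le> m" "w m \<in> A" "\<forall>s. 0 \<le> s \<longrightarrow> s < m \<longrightarrow> w s \<notin> A" "hitting_time A w = ereal m"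
proof -
  let ?S = "{0..} \<inter> w -` A"
  have S: "{s. 0 \<le> s \<and> w s \<in> A} = ?S" by auto
  have closed: "closed ?S"
    using w A by (intro continuous_closed_preimage) auto
  show ?thesis
  proof (cases "?S = {}")
    case True
    show ?thesis
    proof (rule never)
      show "hitting_time A w = \<infinity>"
        unfolding hitting_time_def S True by (simp add: top_ereal_def)
    qed (use True in auto)
  next
    case False
    have bdd: "bdd_below ?S" by (auto intro: bdd_belowI[of _ 0])
    have Inf: "Inf ?S \<in> ?S"
      by (rule closed_contains_Inf[OF False bdd closed])
    have least: "Inf ?S \<le> s" if "s \<in> ?S" for s
      using that bdd by (rule cInf_lower)
    show ?thesis
    proof (rule hits)
      show "hitting_time A w = ereal (Inf ?S)"
        unfolding hitting_time_def S
      proof (rule antisym)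
        show "(INF s\<in>?S. ereal s) \<le> ereal (Inf ?S)" using Inf by (rule INF_lower)
        show "ereal (Inf ?S) \<le> (INF s\<in>?S. ereal s)"
          by (rule INF_greatest) (use least in simp)
      qed
    qed (use Inf least in force)+
  qed
qed

lemma hitting_time_le_iff:
  assumes "continuous_on {0..} w" "closed A"
  shows "hitting_time A w \<le> ereal t \<longleftrightarrow> (\<exists>s\<in>{0..t}. w s \<in> A)"
  using assms
proof (cases rule: hitting_time_cases)
  case never
  then show ?thesis by auto
next
  case (hits m)
  then show ?thesis
    by (auto intro: order_trans)
qed

text \<open>Uncountably many times are reduced to a countable dense set \<open>T\<close>: by
  compactness of \<open>{0..t}\<close>, the set is hit exactly when the distance to it gets
  arbitrarily small along \<open>T\<close>. Nonemptiness of \<open>A\<close> matters because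
  \<open>infdist\<close> to the empty set is \<open>0\<close>.\<close>

lemma borel_measurable_hits:
  fixes Y :: "'a \<Rightarrow> real \<Rightarrow> real"
  assumes Y: "\<And>\<omega>. \<omega> \<in> space M \<Longrightarrow> continuous_on {0..} (Y \<omega>)"
    and meas: "\<And>s. 0 \<le> s \<Longrightarrow> (\<lambda>\<omega>. Y \<omega> s) \<in> borel_measurable M"
    and A: "closed A" "A \<noteq> {}"
  shows "{\<omega> \<in> space M. \<exists>s\<in>{0..t}. Y \<omega> s \<in> A} \<in> sets M"
proof -
  obtain T where T: "countable T" "T \<subseteq> {0..t}" "{0..t} \<subseteq> closure T"
    using separable by blast
  have eq: "(\<exists>s\<in>{0..t}. Y \<omega> s \<in> A) \<longleftrightarrow>
      (\<forall>k::nat. \<exists>q\<in>T. infdist (Y \<omega> q) A < 1 / real (Suc k))" if \<omega>: "\<omega> \<in> space M" for \<omega>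
  proof -
    have cont: "continuous_on {0..t} (\<lambda>s. infdist (Y \<omega> s) A)"
      by (intro continuous_on_infdist continuous_on_subset[OF Y[OF \<omega>]]) auto
    show ?thesis
    proof (intro iffI allI)
      fix k :: nat
      assume "\<exists>s\<in>{0..t}. Y \<omega> s \<in> A"
      then obtain s where s: "s \<in> {0..t}" "Y \<omega> s \<in> A" by blast
      have "\<exists>d>0. \<forall>q\<in>{0..t}. dist q s < d \<longrightarrow> dist (infdist (Y \<omega> q) A) (infdist (Y \<omega> s) A) < 1 / real (Suc k)"
        using cont s(1) unfolding continuous_on_iff by fastforce
      then obtain d where d: "d > 0"
        "\<And>q. q \<in> {0..t} \<Longrightarrow> dist q s < d \<Longrightarrow> dist (infdist (Y \<omega> q) A) (infdist (Y \<omega> s) A) < 1 / real (Suc k)"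
        by blast
      obtain q where q: "q \<in> T" "dist q s < d"
        using T(3) s(1) d(1) closure_approachable by blast
      then have "infdist (Y \<omega> q) A < 1 / real (Suc k)"
        using d(2)[of q] T(2) s(2) by (auto simp: dist_real_def)
      then show "\<exists>q\<in>T. infdist (Y \<omega> q) A < 1 / real (Suc k)"
        using q(1) by blast
    next
      assume *: "\<forall>k::nat. \<exists>q\<in>T. infdist (Y \<omega> q) A < 1 / real (Suc k)"
      then have "{0..t} \<noteq> {}" using T(2) by fastforce
      then obtain s where s: "s \<in> {0..t}" "\<And>r. r \<in> {0..t} \<Longrightarrow> infdist (Y \<omega> s) A \<le> infdist (Y \<omega> r) A"
        using continuous_attains_inf[OF _ _ cont] by blast
      \<comment> \<open>The minimal distance over the interval is below every
        \<open>1 / Suc k\<close>, so it vanishes, and closedness of \<open>A\<close> turns this into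
        a hit.\<close>
      have "infdist (Y \<omega> s) A = 0"
      proof (rule ccontr)
        assume "infdist (Y \<omega> s) A \<noteq> 0"
        then have "infdist (Y \<omega> s) A > 0" using infdist_nonneg[of "Y \<omega> s" A] by linarith
        then obtain k :: nat where "1 / real (Suc k) < infdist (Y \<omega> s) A"
          using nat_approx_posE by blast
        moreover obtain q where "q \<in> T" "infdist (Y \<omega> q) A < 1 / real (Suc k)"
          using * by blast
        ultimately show False using s(2)[of q] T(2) by auto
      qed
      then show "\<exists>s\<in>{0..t}. Y \<omega> s \<in> A"
        using s(1) A in_closed_iff_infdist_zero by blast
    qed
  qed
  have "{\<omega> \<in> space M. \<forall>k::nat. \<exists>q\<in>T. infdist (Y \<omega> q) A < 1 / real (Suc k)} \<in> sets M"
  proof (intro sets.sets_Collect_countable_All sets.sets_Collect_countable_Ex'[OF _ T(1)])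
    fix k :: nat and q assume "q \<in> T"
    then have [measurable]: "(\<lambda>\<omega>. Y \<omega> q) \<in> borel_measurable M" using T(2) by (intro meas) auto
    have [measurable]: "(\<lambda>y. infdist y A) \<in> borel_measurable borel"
      by (intro borel_measurable_continuous_onI continuous_intros)
    show "{\<omega> \<in> space M. infdist (Y \<omega> q) A < 1 / real (Suc k)} \<in> sets M"
      by measurable
  qed
  also have "{\<omega> \<in> space M. \<forall>k::nat. \<exists>q\<in>T. infdist (Y \<omega> q) A < 1 / real (Suc k)} =
      {\<omega> \<in> space M. \<exists>s\<in>{0..t}. Y \<omega> s \<in> A}"
    using eq by blast
  finally show ?thesis .
qed

text \<open>The random time is rounded down to a grid of mesh \<open>1 / Suc n\<close>. Rounded
  times take countably many values, at each of which the path is a measurable coordinate, and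
  continuity of the path carries this to the limit.\<close>

lemma borel_measurable_path_at_random_time:
  fixes Y :: "'a \<Rightarrow> real \<Rightarrow> real"
  assumes Y: "\<And>\<omega>. \<omega> \<in> space M \<Longrightarrow> continuous_on {0..} (Y \<omega>)"
    and meas: "\<And>s. 0 \<le> s \<Longrightarrow> (\<lambda>\<omega>. Y \<omega> s) \<in> borel_measurable M"
    and T: "T \<in> borel_measurable M" "\<And>\<omega>. \<omega> \<in> space M \<Longrightarrow> 0 \<le> T \<omega>"
  shows "(\<lambda>\<omega>. Y \<omega> (T \<omega>)) \<in> borel_measurable M"
proof -
  \<comment> \<open>\<open>nat\<close> keeps every grid time nonnegative, where the coordinates are
    measurable and the paths continuous.\<close>
  define q where "q = (\<lambda>n \<omega>. real (nat \<lfloor>T \<omega> * real (Suc n)\<rfloor>) / real (Suc n))"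
  show ?thesis
  proof (rule borel_measurable_LIMSEQ_metric)
    fix n
    show "(\<lambda>\<omega>. Y \<omega> (q n \<omega>)) \<in> borel_measurable M"
      unfolding q_def
    proof (rule measurable_compose_countable[where g = "\<lambda>\<omega>. nat \<lfloor>T \<omega> * real (Suc n)\<rfloor>"])
      show "(\<lambda>\<omega>. nat \<lfloor>T \<omega> * real (Suc n)\<rfloor>) \<in> measurable M (count_space UNIV)"
        using T(1) by measurable
    qed (auto intro: meas)
  next
    fix \<omega> assume \<omega>: "\<omega> \<in> space M"
    have bounds: "T \<omega> - inverse (real (Suc n)) \<le> q n \<omega>" "q n \<omega> \<le> T \<omega>" for n
    proof -
      have "0 \<le> T \<omega> * real (Suc n)" using T(2)[OF \<omega>] by simp
      then have "real (nat \<lfloor>T \<omega> * real (Suc n)\<rfloor>) = real_of_int \<lfloor>T \<omega> * real (Suc n)\<rfloor>" by simp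
      then have "real (nat \<lfloor>T \<omega> * real (Suc n)\<rfloor>) \<le> T \<omega> * real (Suc n)"
        "T \<omega> * real (Suc n) - 1 \<le> real (nat \<lfloor>T \<omega> * real (Suc n)\<rfloor>)" by linarith+
      moreover have "T \<omega> - inverse (real (Suc n)) = (T \<omega> * real (Suc n) - 1) / real (Suc n)"
        by (simp add: diff_divide_distrib inverse_eq_divide)
      ultimately show "T \<omega> - inverse (real (Suc n)) \<le> q n \<omega>" "q n \<omega> \<le> T \<omega>"
        unfolding q_def
        by (simp_all only: divide_right_mono of_nat_0_le_iff)
          (simp only: pos_divide_le_eq of_nat_0_less_iff zero_less_Suc)
    qed
    have "(\<lambda>n. q n \<omega>) \<longlonglongrightarrow> T \<omega>"
    proof (rule tendsto_sandwich)
      show "(\<lambda>n. T \<omega> - inverse (real (Suc n))) \<longlonglongrightarrow> T \<omega>"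
        using tendsto_diff[OF tendsto_const LIMSEQ_inverse_real_of_nat, of "T \<omega>"] by simp
    qed (use bounds in auto)
    then show "(\<lambda>n. Y \<omega> (q n \<omega>)) \<longlonglongrightarrow> Y \<omega> (T \<omega>)"
      using T(2)[OF \<omega>]
      by (intro continuous_on_tendsto_compose[OF Y[OF \<omega>]]) (auto simp: q_def)
  qed
qed

section \<open>Pathwise behaviour of absorption\<close>

lemma absorb_cases:
  assumes "continuous_on {0..} w"
  obtains (never) "\<forall>s\<ge>0. w s \<noteq> 0 \<and> w s \<noteq> 1" "\<forall>t\<ge>0. absorb w t = w t"
    | (hits) m where "0 \<le> m" "w m = 0 \<or> w m = 1" "\<forall>s. 0 \<le> s \<longrightarrow> s < m \<longrightarrow> w s \<noteq> 0 \<and> w s \<noteq> 1"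
      "\<forall>t\<ge>0. absorb w t = w (min t m)"
proof -
  have "closed {0, 1::real}" by simp
  with assms show thesis
  proof (cases rule: hitting_time_cases)
    case never
    then show ?thesis by (intro that(1)) (auto simp: absorb_def)
  next
    case (hits m)
    have "real_of_ereal (min (ereal t) (ereal m)) = min t m" for t by (simp add: min_def)
    with hits show ?thesis by (intro that(2)[of m]) (auto simp: absorb_def)
  qed
qed

text \<open>A path has at most one first boundary visit. The existence statement is monotone in
  \<open>t\<close>, which shows that a boundary value is never left.\<close>

lemma absorb_at_boundary_iff:
  assumes "continuous_on {0..} w" and t: "0 \<le> t" and a: "a = 0 \<or> a = 1"
  shows "absorb w t = a \<longleftrightarrow>
    (\<exists>s\<in>{0..t}. w s = a \<and> (\<forall>r. 0 \<le> r \<longrightarrow> r < s \<longrightarrow> w r \<noteq> 0 \<and> w r \<noteq> 1))"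
  using assms(1)
proof (cases rule: absorb_cases)
  case never
  then show ?thesis using t a by auto
next
  case (hits m)
  show ?thesis
  proof
    assume "absorb w t = a"
    then have "w (min t m) = a" using hits t by simp
    then show "\<exists>s\<in>{0..t}. w s = a \<and> (\<forall>r. 0 \<le> r \<longrightarrow> r < s \<longrightarrow> w r \<noteq> 0 \<and> w r \<noteq> 1)"
      using hits t by (intro bexI[of _ "min t m"]) auto
  next
    assume "\<exists>s\<in>{0..t}. w s = a \<and> (\<forall>r. 0 \<le> r \<longrightarrow> r < s \<longrightarrow> w r \<noteq> 0 \<and> w r \<noteq> 1)"
    then obtain s where s: "0 \<le> s" "s \<le> t" "w s = a" "\<forall>r. 0 \<le> r \<longrightarrow> r < s \<longrightarrow> w r \<noteq> 0 \<and> w r \<noteq> 1"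
      by auto
    have "s = m"
      using s hits a by (metis linorder_neqE_linordered_idom)
    then show "absorb w t = a"
      using s hits t by simp
  qed
qed

lemma continuous_on_absorb:
  assumes "continuous_on {0..} w"
  shows "continuous_on {0..} (absorb w)"
  using assms
proof (cases rule: absorb_cases)
  case never
  then show ?thesis using assms by (subst continuous_on_cong[where g = w]) auto
next
  case (hits m)
  have "continuous_on {0..} (\<lambda>t. w (min t m))"
    using hits(1) by (intro continuous_on_compose2[OF assms] continuous_intros) auto
  then show ?thesis using hits by (subst continuous_on_cong[where g = "\<lambda>t. w (min t m)"]) auto
qed

lemma hitting_time_absorb_le_iff:
  assumes "continuous_on {0..} w" "0 \<le> t" "a = 0 \<or> a = 1"
  shows "hitting_time {a} (absorb w) \<le> ereal t \<longleftrightarrow> absorb w t = a"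
proof -
  have "hitting_time {a} (absorb w) \<le> ereal t \<longleftrightarrow> (\<exists>s\<in>{0..t}. absorb w s = a)"
    by (subst hitting_time_le_iff[OF continuous_on_absorb[OF assms(1)]]) auto
  also have "\<dots> \<longleftrightarrow> absorb w t = a"
    using assms(2) by (auto simp: absorb_at_boundary_iff[OF assms(1) _ assms(3)] intro: order_trans)
  finally show ?thesis .
qed

text \<open>Coupling of two paths: the lower one reaches \<open>0\<close> no later, and cannot have reached \<open>1\<close> first.\<close>

lemma absorb_zero_mono:
  assumes w: "continuous_on {0..} w" and v: "continuous_on {0..} v"
    and le: "\<And>s. 0 \<le> s \<Longrightarrow> w s \<le> v s" and start: "0 < w 0" "v 0 < 1"
    and t: "0 \<le> t" and abs: "absorb v t = 0"
  shows "absorb w t = 0"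
proof -
  obtain s where s: "0 \<le> s" "s \<le> t" "v s = 0" "\<forall>r. 0 \<le> r \<longrightarrow> r < s \<longrightarrow> v r \<noteq> 0 \<and> v r \<noteq> 1"
    using abs absorb_at_boundary_iff[OF v t, of 0] by auto
  \<comment> \<open>The time \<open>s\<close> is the first boundary visit of \<open>v\<close>; a
    value of at least 1 before it would force a visit to 1 before \<open>s\<close>.\<close>
  have below: "v r < 1" if r: "0 \<le> r" "r \<le> s" for r
  proof (rule ccontr)
    assume "\<not> v r < 1"
    then have "\<exists>q\<ge>0. q \<le> r \<and> v q = 1"
      using start r by (intro IVT') (auto intro: continuous_on_subset[OF v])
    then show False using s r by (metis le_less order_trans zero_neq_one)
  qed
  \<comment> \<open>\<open>w\<close> starts above 0 and lies below \<open>v\<close> at time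
    \<open>s\<close>, so it has reached 0 by then.\<close>
  have "\<exists>q\<ge>0. q \<le> s \<and> w q = 0"
    using start s le[OF s(1)] by (intro IVT2') (auto intro: continuous_on_subset[OF w])
  then obtain q where q: "0 \<le> q" "q \<le> s" "w q = 0" by blast
  from w show ?thesis
  proof (cases rule: absorb_cases)
    case never
    then show ?thesis using q by blast
  next
    case (hits m)
    have "m \<le> q" using hits q by (meson linorder_not_le)
    \<comment> \<open>The exit time \<open>m\<close> of \<open>w\<close> is at most
      \<open>s\<close>, and up to \<open>s\<close> the path \<open>w\<close> stays under
      \<open>v\<close>, hence under 1.\<close>
    then have "w m \<noteq> 1" using below[of m] le[of m] hits(1) q by force
    then show ?thesis using hits t \<open>m \<le> q\<close> q s by auto
  qed
qed

lemma absorb_reflect: "0 \<le> t \<Longrightarrow> absorb (\<lambda>s. 1 - w s) t = 1 - absorb w t"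
proof -
  have "hitting_time {0, 1} (\<lambda>s. 1 - w s) = hitting_time {0, 1} w"
    unfolding hitting_time_def by (intro arg_cong[where f = "\<lambda>S. INF s\<in>S. ereal s"]) auto
  then show "0 \<le> t \<Longrightarrow> ?thesis" by (simp add: absorb_def)
qed

text \<open>Reflection at 1/2 exchanges the two ends and reverses the order of paths, so
  \<open>w\<close> and \<open>v\<close> exchange roles too.\<close>

lemma absorb_one_mono:
  assumes w: "continuous_on {0..} w" and v: "continuous_on {0..} v"
    and le: "\<And>s. 0 \<le> s \<Longrightarrow> w s \<le> v s" and start: "0 < w 0" "v 0 < 1"
    and t: "0 \<le> t" and abs: "absorb w t = 1"
  shows "absorb v t = 1"
proof -
  have "absorb (\<lambda>s. 1 - v s) t = 0"
  proof (rule absorb_zero_mono)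
    show "absorb (\<lambda>s. 1 - w s) t = 0" using abs t by (simp add: absorb_reflect)
  qed (use assms in \<open>auto intro!: continuous_intros\<close>)
  then show ?thesis using t by (simp add: absorb_reflect)
qed

text \<open>Each coordinate of the absorbed path is the original path at a random time, and the
  sublevel sets of that time are hitting events. This makes \<open>abs_law\<close> a genuine image
  measure.\<close>

lemma measurable_absorb:
  fixes Y :: "'a \<Rightarrow> real \<Rightarrow> real"
  assumes Y: "\<And>\<omega>. \<omega> \<in> space M \<Longrightarrow> continuous_on {0..} (Y \<omega>)"
    and meas: "\<And>s. 0 \<le> s \<Longrightarrow> (\<lambda>\<omega>. Y \<omega> s) \<in> borel_measurable M"
  shows "(\<lambda>\<omega>. absorb (Y \<omega>)) \<in> measurable M path_space"
  unfolding path_space_def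
proof (rule measurable_restrict_space2)
  show "(\<lambda>\<omega>. absorb (Y \<omega>)) \<in> space M \<rightarrow> {w. continuous_on {0..} w}"
    using Y continuous_on_absorb by blast
  show "(\<lambda>\<omega>. absorb (Y \<omega>)) \<in> measurable M (Pi\<^sub>M {0..} (\<lambda>_. borel))"
    unfolding absorb_def
  proof (rule measurable_restrict)
    fix t :: real assume "t \<in> {0..}"
    then have t: "0 \<le> t" by simp
    let ?T = "\<lambda>\<omega>. real_of_ereal (min (ereal t) (hitting_time {0, 1} (Y \<omega>)))"
    have T_le: "?T \<omega> \<le> c \<longleftrightarrow> t \<le> c \<or> (\<exists>s\<in>{0..c}. Y \<omega> s \<in> {0, 1})"
      and T_nonneg: "0 \<le> ?T \<omega>" if \<omega>: "\<omega> \<in> space M" for \<omega> c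
    proof -
      have A: "closed {0, 1::real}" by simp
      have min: "real_of_ereal (min (ereal t) (ereal m)) = min t m" for m by (simp add: min_def)
      have "(?T \<omega> \<le> c \<longleftrightarrow> t \<le> c \<or> hitting_time {0, 1} (Y \<omega>) \<le> ereal c) \<and> 0 \<le> ?T \<omega>"
        using Y[OF \<omega>] A
      proof (cases rule: hitting_time_cases)
        case never
        show ?thesis unfolding never(2) using t by simp
      next
        case (hits m)
        show ?thesis unfolding hits(4) using t hits(1) by (simp add: min min_le_iff_disj)
      qed
      then show "?T \<omega> \<le> c \<longleftrightarrow> t \<le> c \<or> (\<exists>s\<in>{0..c}. Y \<omega> s \<in> {0, 1})" "0 \<le> ?T \<omega>"
        unfolding hitting_time_le_iff[OF Y[OF \<omega>] A] by auto
    qed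
    have T_meas: "?T \<in> borel_measurable M"
      unfolding borel_measurable_iff_le
    proof
      fix c
      have "{\<omega> \<in> space M. \<exists>s\<in>{0..c}. Y \<omega> s \<in> {0, 1}} \<in> sets M"
        by (rule borel_measurable_hits[OF Y meas]) auto
      moreover have "{\<omega> \<in> space M. ?T \<omega> \<le> c} =
          (if t \<le> c then space M else {\<omega> \<in> space M. \<exists>s\<in>{0..c}. Y \<omega> s \<in> {0, 1}})"
        using T_le by auto
      ultimately show "{\<omega> \<in> space M. ?T \<omega> \<le> c} \<in> sets M" by simp
    qed
    show "(\<lambda>\<omega>. Y \<omega> (?T \<omega>)) \<in> borel_measurable M"
      by (rule borel_measurable_path_at_random_time[OF Y meas T_meas T_nonneg])
  qed
qed

lemma gas_intensity_nonneg:
  assumes "0 \<le> lam\<^sub>L" "0 \<le> lam\<^sub>R"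
  shows "0 \<le> gas_intensity V lam\<^sub>L lam\<^sub>R t x"
  using assms by (simp add: gas_intensity_def)

section \<open>The law of absorbed Brownian motion\<close>

context
  fixes V :: "(real \<Rightarrow> real) measure"
  assumes V: "wiener_measure V"
begin

lemma prob_space_wiener: "prob_space V"
  using V by (simp add: wiener_measure_def)

lemma sets_wiener: "sets V = sets path_space"
  using V by (simp add: wiener_measure_def)

lemma continuous_shifted_path:
  assumes "w \<in> space V"
  shows "continuous_on {0..} (\<lambda>s. x + w s)"
  using assms sets_eq_imp_space_eq[OF sets_wiener] by (auto simp: space_path_space intro!: continuous_intros)

lemma measurable_absorb_shift: "(\<lambda>w. absorb (\<lambda>s. x + w s)) \<in> measurable V path_space"
proof (rule measurable_absorb)
  fix s :: real assume "0 \<le> s"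
  then have "(\<lambda>w. w s) \<in> borel_measurable V"
    using measurable_cong_sets[OF sets_wiener refl] measurable_path_component by blast
  then show "(\<lambda>w. x + w s) \<in> borel_measurable V" by simp
qed (rule continuous_shifted_path)

lemma prob_space_abs_law: "prob_space (abs_law V x)"
  unfolding abs_law_def by (rule prob_space.prob_space_distr[OF prob_space_wiener measurable_absorb_shift])

lemma sets_abs_law: "sets (abs_law V x) = sets path_space"
  by (simp add: abs_law_def)

text \<open>On general paths, having hit \<open>a\<close> and being at \<open>a\<close> are
  different events. They coincide on absorbed paths, so both are pulled back along
  \<open>absorb\<close> to the Wiener space.\<close>

lemma measure_hitting_eq:
  assumes t: "0 \<le> t" and a: "a = 0 \<or> a = 1"
  shows "measure (abs_law V x) {w \<in> space path_space. hitting_time {a} w \<le> ereal t} =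
      measure V {w \<in> space V. absorb (\<lambda>s. x + w s) t = a}"
    and "measure (abs_law V x) {w \<in> space path_space. w t = a} =
      measure V {w \<in> space V. absorb (\<lambda>s. x + w s) t = a}"
proof -
  note f = measurable_absorb_shift[of x]
  have "{w \<in> space path_space. \<exists>s\<in>{0..t}. w s \<in> {a}} \<in> sets path_space"
    by (rule borel_measurable_hits) (auto simp: space_path_space)
  also have "{w \<in> space path_space. \<exists>s\<in>{0..t}. w s \<in> {a}} =
      {w \<in> space path_space. hitting_time {a} w \<le> ereal t}"
    using hitting_time_le_iff[of _ "{a}"] by (auto simp: space_path_space)
  finally have meas: "{w \<in> space path_space. hitting_time {a} w \<le> ereal t} \<in> sets path_space" .
  show "measure (abs_law V x) {w \<in> space path_space. hitting_time {a} w \<le> ereal t} =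
      measure V {w \<in> space V. absorb (\<lambda>s. x + w s) t = a}"
    unfolding abs_law_def measure_distr[OF f meas]
    using measurable_space[OF f] hitting_time_absorb_le_iff[OF continuous_shifted_path t a]
    by (intro arg_cong[where f = "measure V"]) auto
  have meas': "{w \<in> space path_space. w t = a} \<in> sets path_space"
    using t by measurable
  show "measure (abs_law V x) {w \<in> space path_space. w t = a} =
      measure V {w \<in> space V. absorb (\<lambda>s. x + w s) t = a}"
    unfolding abs_law_def measure_distr[OF f meas']
    using measurable_space[OF f] by (intro arg_cong[where f = "measure V"]) auto
qed

lemma gas_intensity_eq:
  assumes "0 \<le> t"
  shows "gas_intensity V lam\<^sub>L lam\<^sub>R t x =
    lam\<^sub>L * measure (abs_law V x) {w \<in> space path_space. w t = 0} +
    lam\<^sub>R * measure (abs_law V x) {w \<in> space path_space. w t = 1}"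
  using measure_hitting_eq[OF assms] by (simp add: gas_intensity_def)

text \<open>Measurability in the starting point comes for free from monotonicity: under the coupling, the
  probability of exit at \<open>0\<close> decreases and that of exit at \<open>1\<close> increases with the starting point.\<close>

lemma borel_measurable_gas_intensity:
  assumes t: "0 \<le> t"
  shows "gas_intensity V lam\<^sub>L lam\<^sub>R t \<in> borel_measurable (restrict_space borel {0<..<1})"
proof -
  interpret prob_space V by (rule prob_space_wiener)
  let ?E = "\<lambda>a x. {w \<in> space V. absorb (\<lambda>s. x + w s) t = a}"
  have E: "?E a x \<in> sets V" for a x
    using measurable_compose[OF measurable_absorb_shift measurable_path_component[OF t], of x]
    by measurable
  \<comment> \<open>The starting value is only almost surely 0, so the coupled exit events are
    nested up to a null set.\<close>
  have start: "AE w in V. w 0 = 0"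
    using V by (simp add: wiener_measure_def)
  have "mono_on {0<..<1} (\<lambda>x. - prob (?E 0 x))"
  proof (rule mono_onI)
    fix x y :: real assume xy: "x \<in> {0<..<1}" "y \<in> {0<..<1}" "x \<le> y"
    have "AE w in V. w \<in> ?E 0 y \<longrightarrow> w \<in> ?E 0 x"
      using start AE_space
    proof eventually_elim
      case (elim w)
      show ?case
        using absorb_zero_mono[OF continuous_shifted_path continuous_shifted_path, of w w x y t] elim xy t by auto
    qed
    then show "- prob (?E 0 x) \<le> - prob (?E 0 y)"
      using finite_measure_mono_AE[OF _ E] by simp
  qed
  then have "(\<lambda>x. - prob (?E 0 x)) \<in> borel_measurable (restrict_space borel {0<..<1})"
    by (rule borel_measurable_mono_on_fnc)
  then have 0: "(\<lambda>x. prob (?E 0 x)) \<in> borel_measurable (restrict_space borel {0<..<1})"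
    by (simp only: borel_measurable_uminus_eq)
  have "mono_on {0<..<1} (\<lambda>x. prob (?E 1 x))"
  proof (rule mono_onI)
    fix x y :: real assume xy: "x \<in> {0<..<1}" "y \<in> {0<..<1}" "x \<le> y"
    have "AE w in V. w \<in> ?E 1 x \<longrightarrow> w \<in> ?E 1 y"
      using start AE_space
    proof eventually_elim
      case (elim w)
      show ?case
        using absorb_one_mono[OF continuous_shifted_path continuous_shifted_path, of w w x y t] elim xy t by auto
    qed
    then show "prob (?E 1 x) \<le> prob (?E 1 y)"
      using finite_measure_mono_AE[OF _ E] by simp
  qed
  then have 1: "(\<lambda>x. prob (?E 1 x)) \<in> borel_measurable (restrict_space borel {0<..<1})"
    by (rule borel_measurable_mono_on_fnc)
  show ?thesis
    using 0 1 unfolding gas_intensity_def measure_hitting_eq(1)[OF t disjI1[OF refl]]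
      measure_hitting_eq(1)[OF t disjI2[OF refl]] by measurable
qed

end

section \<open>Factorial moments of a Poisson process\<close>

text \<open>The cells are the atoms of the algebra generated by the sets \<open>A j\<close>. Expanding along them turns the
  factorial measure of an arbitrary rectangle into a polynomial in the numbers of points in disjoint
  sets, to which the independence property of a Poisson process applies.\<close>

definition cell :: "'j set \<Rightarrow> ('j \<Rightarrow> 'a set) \<Rightarrow> 'a set \<Rightarrow> 'j set \<Rightarrow> 'a set" where
  "cell J A U S = {x \<in> U. \<forall>j\<in>J. x \<in> A j \<longleftrightarrow> j \<in> S}"

text \<open>\<open>c\<close> chooses for each position a cell inside its set \<open>A j\<close>, and
  the falling factorials count the placements compatible with \<open>c\<close>. Intersecting with
  \<open>U\<close> matters for the cell that misses every \<open>A j\<close>: it has to be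
  measurable for the process as well.\<close>

definition factorial_count ::
    "'j set \<Rightarrow> ('j \<Rightarrow> real set) \<Rightarrow> real set \<Rightarrow> real multiset \<Rightarrow> 'b::comm_semiring_1" where
  "factorial_count J A U \<eta> =
     (\<Sum>c\<in>PiE J (\<lambda>j. {S \<in> Pow J. j \<in> S}). \<Prod>S\<in>Pow J.
        of_nat (fact (card {j \<in> J. c j = S}) * (num_points \<eta> (cell J A U S) choose card {j \<in> J. c j = S})))"

lemma disjoint_cell: "disjoint_family_on (cell J A U) (Pow J)"
  unfolding disjoint_family_on_def
proof (intro ballI impI)
  fix S T assume "S \<in> Pow J" "T \<in> Pow J" "S \<noteq> T"
  then obtain j where "j \<in> J" "j \<in> S \<longleftrightarrow> j \<notin> T" by blast
  then show "cell J A U S \<inter> cell J A U T = {}" by (auto simp: cell_def)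
qed

lemma cell_Union:
  assumes "j \<in> J" "A j \<subseteq> U"
  shows "(\<Union>S\<in>{S \<in> Pow J. j \<in> S}. cell J A U S) = A j"
proof (intro equalityI subsetI)
  fix x assume x: "x \<in> A j"
  show "x \<in> (\<Union>S\<in>{S \<in> Pow J. j \<in> S}. cell J A U S)"
  proof (rule UN_I)
    show "{l \<in> J. x \<in> A l} \<in> {S \<in> Pow J. j \<in> S}"
      using assms(1) x by simp
    show "x \<in> cell J A U {l \<in> J. x \<in> A l}"
      using assms x by (simp add: cell_def subset_iff)
  qed
next
  fix x assume "x \<in> (\<Union>S\<in>{S \<in> Pow J. j \<in> S}. cell J A U S)"
  then show "x \<in> A j"
    using assms(1) by (auto simp only: cell_def UN_iff mem_Collect_eq)
qed

lemma disjoint_cell_subset: "disjoint_family_on (cell J A U) {S \<in> Pow J. j \<in> S}"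
  by (rule disjoint_family_on_mono[OF _ disjoint_cell]) auto

text \<open>This is the passage from an enumeration to counts. Each indicator splits into indicators
  of cells, and multilinearity leaves one cell per position. Points of \<open>xs\<close> outside
  \<open>U\<close> are allowed, which covers absorbed particles.\<close>

lemma inj_sum_indicator:
  assumes J: "finite J" and A: "\<And>j. j \<in> J \<Longrightarrow> A j \<subseteq> U"
  shows "inj_sum J xs (\<lambda>j. indicator (A j)) = factorial_count J A U (mset xs)"
proof -
  have "inj_sum J xs (\<lambda>j. indicator (A j)) =
      inj_sum J xs (\<lambda>j x. \<Sum>S\<in>{S \<in> Pow J. j \<in> S}. indicator (cell J A U S) x)"
  proof (rule inj_sum_cong)
    fix j x assume j: "j \<in> J"
    show "indicator (A j) x = (\<Sum>S\<in>{S \<in> Pow J. j \<in> S}. indicator (cell J A U S) x)"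
      using J indicator_UN_disjoint[OF _ disjoint_cell_subset, of J j A U x]
        cell_Union[of j J A U] A[OF j] j by simp
  qed
  also have "\<dots> = (\<Sum>c\<in>PiE J (\<lambda>j. {S \<in> Pow J. j \<in> S}). inj_sum J xs (\<lambda>j. indicator (cell J A U (c j))))"
    using J by (intro inj_sum_sum) auto
  also have "\<dots> = factorial_count J A U (mset xs)"
    unfolding factorial_count_def
    by (intro sum.cong refl inj_sum_disjoint disjoint_cell) (use J in \<open>auto simp: PiE_iff\<close>)
  finally show ?thesis .
qed

lemma sets_cell:
  assumes "finite J" "\<And>j. j \<in> J \<Longrightarrow> A j \<in> sets M" "U \<in> sets M" "U \<subseteq> space M"
  shows "cell J A U S \<in> sets M"
proof -
  have "{x \<in> space M. x \<in> A j \<longleftrightarrow> j \<in> S} \<in> sets M" if j: "j \<in> J" for j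
  proof (cases "j \<in> S")
    case True
    then have "{x \<in> space M. x \<in> A j \<longleftrightarrow> j \<in> S} = A j"
      using sets.sets_into_space[OF assms(2)[OF j]] by auto
    then show ?thesis using assms(2)[OF j] by simp
  next
    case False
    then have "{x \<in> space M. x \<in> A j \<longleftrightarrow> j \<in> S} = space M - A j" by auto
    then show ?thesis using assms(2)[OF j] by auto
  qed
  then have "{x \<in> space M. \<forall>j\<in>J. x \<in> A j \<longleftrightarrow> j \<in> S} \<in> sets M"
    using assms(1) by (rule sets.sets_Collect_finite_All)
  then have "U \<inter> {x \<in> space M. \<forall>j\<in>J. x \<in> A j \<longleftrightarrow> j \<in> S} \<in> sets M"
    using assms(3) by (rule sets.Int[rotated])
  also have "U \<inter> {x \<in> space M. \<forall>j\<in>J. x \<in> A j \<longleftrightarrow> j \<in> S} = cell J A U S"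
    using assms(4) by (auto simp: cell_def)
  finally show ?thesis .
qed

lemma measurable_num_points:
  assumes "A \<in> sets borel"
  shows "(\<lambda>\<eta>. num_points \<eta> A) \<in> measurable config_space (count_space UNIV)"
proof (rule measurable_count_space_eq2_countable[THEN iffD2])
  have "{\<eta>. num_points \<eta> A = k} \<in> sets config_space" for k
    unfolding config_space_def using assms by (intro in_measure_of) blast+
  then show "(\<lambda>\<eta>. num_points \<eta> A) \<in> space config_space \<rightarrow> UNIV \<and>
      (\<forall>a\<in>UNIV. (\<lambda>\<eta>. num_points \<eta> A) -` {a} \<inter> space config_space \<in> sets config_space)"
    by (simp add: vimage_def config_space_def space_measure_of_conv)
qed

lemma measurable_factorial_count:
  assumes "finite J" "\<And>j. j \<in> J \<Longrightarrow> A j \<in> sets borel" "U \<in> sets borel"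
  shows "(factorial_count J A U :: _ \<Rightarrow> ennreal) \<in> borel_measurable config_space"
proof -
  have [measurable]: "(\<lambda>\<eta>. num_points \<eta> (cell J A U S)) \<in> measurable config_space (count_space UNIV)" for S
    by (intro measurable_num_points sets_cell[where M = borel] assms; simp)
  show ?thesis
    unfolding factorial_count_def by measurable
qed

text \<open>The falling factorial cancels against \<open>fact n\<close> in the Poisson weights, and
  the exponential series shifted by \<open>k\<close> remains.\<close>

lemma (in prob_space) poisson_factorial_moment:
  assumes X: "X \<in> measurable M (count_space UNIV)" and r: "0 \<le> r"
    and pois: "\<And>k. prob {\<omega> \<in> space M. X \<omega> = k} = r ^ k / fact k * exp (- r)"
  shows "(\<integral>\<^sup>+\<omega>. of_nat (fact k * (X \<omega> choose k)) \<partial>M) = ennreal (r ^ k)"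
proof -
  let ?p = "\<lambda>n. ennreal (r ^ n / fact n * exp (- r))"
  have "emeasure (distr M (count_space UNIV) X) {n} = ?p n" for n
    unfolding pois[symmetric] using X
    by (simp add: emeasure_distr emeasure_eq_measure vimage_def Int_def conj_commute)
  then have distr: "distr M (count_space UNIV) X = density (count_space UNIV) ?p"
    by (intro measure_eqI_countable[of _ UNIV])
       (simp_all add: emeasure_density nn_integral_count_space_indicator[symmetric])
  have "(\<integral>\<^sup>+\<omega>. of_nat (fact k * (X \<omega> choose k)) \<partial>M) =
      (\<integral>\<^sup>+n. of_nat (fact k * (n choose k)) \<partial>density (count_space UNIV) ?p)"
    unfolding distr[symmetric] using X by (subst nn_integral_distr) auto
  also have "\<dots> = (\<Sum>n. ennreal (r ^ n / fact n * exp (- r) * of_nat (fact k * (n choose k))))"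
    unfolding nn_integral_count_space_nat[symmetric]
    using r by (subst nn_integral_density)
      (auto simp: ennreal_of_nat_eq_real_of_nat ennreal_mult[symmetric] intro!: nn_integral_cong)
  also have "\<dots> = ennreal (r ^ k)"
  proof (rule suminf_ennreal_eq)
    let ?f = "\<lambda>n. r ^ n / fact n * exp (- r) * of_nat (fact k * (n choose k))"
    have "(\<lambda>n. r ^ k * exp (- r) * (r ^ n /\<^sub>R fact n)) sums (r ^ k * exp (- r) * exp r)"
      by (intro sums_mult exp_converges)
    also have "(\<lambda>n. r ^ k * exp (- r) * (r ^ n /\<^sub>R fact n)) = (\<lambda>n. ?f (n + k))"
      by (rule ext) (simp add: binomial_fact power_add field_simps)
    finally have "?f sums (r ^ k * exp (- r) * exp r + (\<Sum>n<k. ?f n))"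
      by (rule sums_iff_shift[THEN iffD1])
    \<comment> \<open>The terms skipped by the shift contain a vanishing binomial
      coefficient.\<close>
    also have "(\<Sum>n<k. ?f n) = 0"
      by (intro sum.neutral) (simp add: binomial_eq_0)
    also have "r ^ k * exp (- r) * exp r + 0 = r ^ k"
      by (simp add: exp_minus)
    finally show "?f sums r ^ k" .
  qed (use r in auto)
  finally show ?thesis .
qed

text \<open>For a fixed choice of cells, independence and the Poisson factorial moments give the
  mass of the chosen cell as one factor per position. Summing over all choices gives a product of
  sums, and the cells inside \<open>A j\<close> add up to \<open>A j\<close>.\<close>

lemma poisson_point_process_factorial_count:
  assumes P: "prob_space P" and pois: "poisson_point_process P \<mu> \<Theta>"
    and J: "finite J" and A: "\<And>j. j \<in> J \<Longrightarrow> A j \<in> sets \<mu>" and \<mu>: "sets \<mu> \<subseteq> sets borel"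
  shows "(\<integral>\<^sup>+\<omega>. factorial_count J A (space \<mu>) (\<Theta> \<omega>) \<partial>P) = (\<Prod>j\<in>J. emeasure \<mu> (A j))"
proof -
  interpret prob_space P by fact
  interpret mu: finite_measure \<mu>
    using pois by (simp add: poisson_point_process_def)
  let ?B = "cell J A (space \<mu>)"
  let ?k = "\<lambda>c S. card {j \<in> J. c j = S}"
  have B: "?B S \<in> sets \<mu>" for S
    using J A by (intro sets_cell) auto
  have B': "?B S \<in> sets borel" for S
    using B \<mu> by blast
  have \<Theta>: "\<Theta> \<in> measurable P config_space"
    using pois by (simp add: poisson_point_process_def)
  have num [measurable]: "(\<lambda>\<omega>. num_points (\<Theta> \<omega>) (?B S)) \<in> measurable P (count_space UNIV)" for S
    using measurable_compose[OF \<Theta> measurable_num_points[OF B']] .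
  have moment: "(\<integral>\<^sup>+\<omega>. of_nat (fact k * (num_points (\<Theta> \<omega>) (?B S) choose k)) \<partial>P) = emeasure \<mu> (?B S) ^ k" for S k
  proof -
    have "(\<integral>\<^sup>+\<omega>. of_nat (fact k * (num_points (\<Theta> \<omega>) (?B S) choose k)) \<partial>P) = ennreal (measure \<mu> (?B S) ^ k)"
      by (rule poisson_factorial_moment[OF num]) (use pois B in \<open>auto simp: poisson_point_process_def\<close>)
    then show ?thesis
      by (simp add: mu.emeasure_eq_measure ennreal_power)
  qed
  \<comment> \<open>Independence is assumed for families indexed by initial segments of the
    naturals, so the cells are enumerated.\<close>
  obtain e where e: "bij_betw e {..<card (Pow J)} (Pow J)"
    using ex_bij_betw_nat_finite[of "Pow J"] J by (auto simp: atLeast0LessThan)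
  let ?m = "card (Pow J)"
  have "disjoint_family_on (\<lambda>i. ?B (e i)) {..<?m}"
    unfolding disjoint_family_on_def
  proof (intro ballI impI)
    fix i l assume "i \<in> {..<?m}" "l \<in> {..<?m}" "i \<noteq> l"
    then have "e i \<in> Pow J" "e l \<in> Pow J" "e i \<noteq> e l"
      using bij_betw_imp_inj_on[OF e] bij_betwE[OF e] by (auto dest: inj_onD)
    then show "?B (e i) \<inter> ?B (e l) = {}"
      using disjoint_cell[of J A "space \<mu>"] unfolding disjoint_family_on_def by blast
  qed
  then have "indep_vars (\<lambda>_. count_space UNIV) (\<lambda>i \<omega>. num_points (\<Theta> \<omega>) (?B (e i))) {..<?m}"
    using pois B by (simp add: poisson_point_process_def)
  then have indep: "indep_vars (\<lambda>_. borel) (\<lambda>i \<omega>. of_nat (fact (k i) * (num_points (\<Theta> \<omega>) (?B (e i)) choose k i)) :: ennreal) {..<?m}" for k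
    by (rule indep_vars_compose2) simp
  have prod: "(\<integral>\<^sup>+\<omega>. (\<Prod>S\<in>Pow J. of_nat (fact (?k c S) * (num_points (\<Theta> \<omega>) (?B S) choose ?k c S))) \<partial>P) =
      (\<Prod>j\<in>J. emeasure \<mu> (?B (c j)))" if c: "c \<in> PiE J (\<lambda>j. {S \<in> Pow J. j \<in> S})" for c
  proof -
    have "(\<integral>\<^sup>+\<omega>. (\<Prod>S\<in>Pow J. of_nat (fact (?k c S) * (num_points (\<Theta> \<omega>) (?B S) choose ?k c S))) \<partial>P) =
        (\<integral>\<^sup>+\<omega>. (\<Prod>i<?m. of_nat (fact (?k c (e i)) * (num_points (\<Theta> \<omega>) (?B (e i)) choose ?k c (e i)))) \<partial>P)"
      by (intro nn_integral_cong prod.reindex_bij_betw[OF e, symmetric])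
    also have "\<dots> = (\<Prod>i<?m. emeasure \<mu> (?B (e i)) ^ ?k c (e i))"
      by (subst indep_vars_nn_integral[OF _ indep[of "\<lambda>i. ?k c (e i)"]]) (simp_all add: moment del: of_nat_mult)
    also have "\<dots> = (\<Prod>S\<in>Pow J. emeasure \<mu> (?B S) ^ ?k c S)"
      by (rule prod.reindex_bij_betw[OF e])
    \<comment> \<open>The exponent of a cell is the number of positions assigned to it, so the
      powers unfold into one factor per position.\<close>
    also have "\<dots> = (\<Prod>S\<in>Pow J. \<Prod>j\<in>{j \<in> J. c j = S}. emeasure \<mu> (?B (c j)))"
      by (intro prod.cong refl) simp
    also have "\<dots> = (\<Prod>j\<in>J. emeasure \<mu> (?B (c j)))"
      using J c by (intro prod.group) auto
    finally show ?thesis .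
  qed
  have "(\<integral>\<^sup>+\<omega>. factorial_count J A (space \<mu>) (\<Theta> \<omega>) \<partial>P) =
      (\<Sum>c\<in>PiE J (\<lambda>j. {S \<in> Pow J. j \<in> S}). \<Prod>j\<in>J. emeasure \<mu> (?B (c j)))"
    unfolding factorial_count_def
    by (subst nn_integral_sum) (measurable, intro sum.cong refl prod)
  also have "\<dots> = (\<Prod>j\<in>J. \<Sum>S\<in>{S \<in> Pow J. j \<in> S}. emeasure \<mu> (?B S))"
    using J by (intro prod_sum_PiE[symmetric]) auto
  also have "\<dots> = (\<Prod>j\<in>J. emeasure \<mu> (A j))"
  proof (intro prod.cong refl)
    fix j assume j: "j \<in> J"
    have "(\<Sum>S\<in>{S \<in> Pow J. j \<in> S}. emeasure \<mu> (?B S)) = emeasure \<mu> (\<Union>S\<in>{S \<in> Pow J. j \<in> S}. ?B S)"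
      using J B by (intro sum_emeasure disjoint_cell_subset) auto
    then show "(\<Sum>S\<in>{S \<in> Pow J. j \<in> S}. emeasure \<mu> (?B S)) = emeasure \<mu> (A j)"
      unfolding cell_Union[of j J A "space \<mu>", OF j sets.sets_into_space[OF A[OF j]]] .
  qed
  finally show ?thesis .
qed

section \<open>The moment density\<close>

lemma num_points_config_of: "num_points (config_of k y) A = (\<Sum>i\<in>{1..k}. of_bool (y i \<in> A))"
  by (simp add: num_points_def config_of_def filter_mset_image_mset sum_of_bool_eq Int_def)

text \<open>Requiring all \<open>k\<close> points to be on the boundary makes the weight
  multiplicative: a point contributes \<open>a\<close> at 0, \<open>b\<close> at 1 and nothing
  elsewhere.\<close>

lemma boundary_weight_eq_prod:
  fixes a b :: "'b::comm_semiring_1"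
  shows "a ^ num_points (config_of k y) {0} * b ^ num_points (config_of k y) {1} *
      of_bool (num_points (config_of k y) {0, 1} = k) =
    (\<Prod>i\<in>{1..k}. a * of_bool (y i = 0) + b * of_bool (y i = 1))"
proof (cases "\<forall>i\<in>{1..k}. y i = 0 \<or> y i = 1")
  case True
  then have "num_points (config_of k y) {0, 1} = k"
    by (simp add: num_points_config_of)
  \<comment> \<open>One exponent is 1 and the other 0; for a zero parameter this relies on
    \<open>0 ^ 0 = 1\<close>.\<close>
  moreover have "a ^ of_bool (y i = 0) * b ^ of_bool (y i = 1) = a * of_bool (y i = 0) + b * of_bool (y i = 1)"
    if "i \<in> {1..k}" for i
    using True that by auto
  ultimately show ?thesis
    by (simp only: num_points_config_of power_sum prod.distrib[symmetric] singleton_iff refl of_bool_eq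
        mult_1_right cong: prod.cong)
next
  case False
  then obtain i where i: "i \<in> {1..k}" "y i \<noteq> 0" "y i \<noteq> 1" by auto
  have "num_points (config_of k y) {0, 1} < (\<Sum>i\<in>{1..k}. 1)"
    unfolding num_points_config_of by (rule sum_strict_mono_ex1) (use i in auto)
  moreover have "(\<Prod>i\<in>{1..k}. a * of_bool (y i = 0) + b * of_bool (y i = 1)) = 0"
    by (rule prod_zero) (use i in auto)
  ultimately show ?thesis by simp
qed

text \<open>The weight factors over independent particles, and each one-particle expectation is the
  Poisson intensity at its starting point. This is how the boundary term of the formula meets the
  product density of the Poisson part.\<close>

lemma abs_expectation_boundary_weight:
  assumes V: "wiener_measure V" and t: "0 \<le> t"
  shows "abs_expectation V k z
      (\<lambda>\<xi>. lam\<^sub>L ^ num_points (\<xi> t) {0} * lam\<^sub>R ^ num_points (\<xi> t) {1} *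
        of_bool (num_points (\<xi> t) {0, 1} = k)) =
    (\<Prod>i\<in>{1..k}. gas_intensity V lam\<^sub>L lam\<^sub>R t (z i))"
proof -
  let ?h = "\<lambda>w. lam\<^sub>L * of_bool (w t = 0) + lam\<^sub>R * of_bool (w t = 1)"
  have prob: "prob_space (abs_law V u)" for u
    by (rule prob_space_abs_law[OF V])
  interpret product_sigma_finite "\<lambda>i. abs_law V (z i)"
    unfolding product_sigma_finite_def
    using prob prob_space_imp_sigma_finite by blast
  have comp: "(\<lambda>w. w t) \<in> borel_measurable (abs_law V u)" for u
    using measurable_path_component[OF t] measurable_cong_sets[OF sets_abs_law[OF V] refl] by blast
  have space: "space (abs_law V u) = space path_space" for u
    by (rule sets_eq_imp_space_eq[OF sets_abs_law[OF V]])
  have h: "?h = (\<lambda>w. lam\<^sub>L * indicator {w. w t = 0} w + lam\<^sub>R * indicator {w. w t = 1} w)"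
    by (auto simp: fun_eq_iff)
  have int: "integrable (abs_law V u) ?h"
    and eq: "integral\<^sup>L (abs_law V u) ?h = gas_intensity V lam\<^sub>L lam\<^sub>R t u" for u
  proof -
    interpret prob_space "abs_law V u" by (rule prob)
    have meas: "{w \<in> space (abs_law V u). w t = a} \<in> sets (abs_law V u)" for a
      using comp[of u] by measurable
    have ind: "has_bochner_integral (abs_law V u) (indicator {w. w t = a} :: _ \<Rightarrow> real)
        (prob {w \<in> space (abs_law V u). w t = a})" for a
    proof -
      \<comment> \<open>\<open>{w. w t = a}\<close> ranges over all functions; its trace on the path
        space is the measurable event.\<close>
      have "has_bochner_integral (abs_law V u) (indicator {w \<in> space (abs_law V u). w t = a} :: _ \<Rightarrow> real)
        (prob {w \<in> space (abs_law V u). w t = a})"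
        by (rule has_bochner_integral_real_indicator[OF meas]) (simp add: emeasure_eq_measure)
      then show ?thesis
        by (rule has_bochner_integral_cong[THEN iffD1, rotated -1]) (auto simp: indicator_def)
    qed
    have "has_bochner_integral (abs_law V u) ?h (gas_intensity V lam\<^sub>L lam\<^sub>R t u)"
      unfolding h gas_intensity_eq[OF V t] space[of u, symmetric]
      by (intro has_bochner_integral_add has_bochner_integral_mult_right ind)
    then show "integrable (abs_law V u) ?h" "integral\<^sup>L (abs_law V u) ?h = gas_intensity V lam\<^sub>L lam\<^sub>R t u"
      by (auto simp: has_bochner_integral_iff)
  qed
  have "abs_expectation V k z
      (\<lambda>\<xi>. lam\<^sub>L ^ num_points (\<xi> t) {0} * lam\<^sub>R ^ num_points (\<xi> t) {1} *
        of_bool (num_points (\<xi> t) {0, 1} = k)) =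
      (\<integral>w. (\<Prod>i\<in>{1..k}. ?h (w i)) \<partial>PiM {1..k} (\<lambda>i. abs_law V (z i)))"
    unfolding abs_expectation_def particle_config_def boundary_weight_eq_prod ..
  also have "\<dots> = (\<Prod>i\<in>{1..k}. gas_intensity V lam\<^sub>L lam\<^sub>R t (z i))"
    using product_integral_prod[of "{1..k}" "\<lambda>_. ?h"] int eq by simp
  finally show ?thesis .
qed

section \<open>Lebesgue measure on the interval and factorial measures of lists\<close>

lemma space_unit_lebesgue [simp]: "space unit_lebesgue = {0<..<1}"
  by (simp add: unit_lebesgue_def space_restrict_space)

lemma sets_unit_lebesgue: "A \<in> sets unit_lebesgue \<longleftrightarrow> A \<in> sets borel \<and> A \<subseteq> {0<..<1}"
  unfolding unit_lebesgue_def by (subst sets_restrict_space_iff) auto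

lemma sigma_finite_unit_lebesgue: "sigma_finite_measure unit_lebesgue"
  unfolding unit_lebesgue_def by (intro sigma_finite_measure_restrict_space sigma_finite_lborel) auto

lemma measurable_unit_lebesgue:
  "f \<in> borel_measurable (restrict_space borel {0<..<1}) \<Longrightarrow> f \<in> borel_measurable unit_lebesgue"
  unfolding unit_lebesgue_def
  by (subst measurable_cong_sets[OF sets_restrict_space_cong[OF sets_lborel] refl])

lemma tuples_in_space:
  assumes "set xs \<subseteq> {0<..<1}"
  shows "(\<lambda>i. \<lambda>j\<in>{1..n}. xs ! i j) \<in>
    measurable (count_space (injections {1..n} (length xs))) (PiM {1..n} (\<lambda>_. unit_lebesgue))"
  unfolding measurable_count_space_eq1 space_PiM space_unit_lebesgue
  by (intro Pi_I restrict_PiE_iff[THEN iffD2] ballI subsetD[OF assms] nth_mem) (rule injections_mem)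

lemma integral_factorial_measure:
  fixes f :: "_ \<Rightarrow> real"
  assumes xs: "set xs \<subseteq> {0<..<1}" and f: "f \<in> borel_measurable (PiM {1..n} (\<lambda>_. unit_lebesgue))"
  shows "(\<integral>y. f y \<partial>factorial_measure n (mset xs)) =
    (\<Sum>i\<in>injections {1..n} (length xs). f (\<lambda>j\<in>{1..n}. xs ! i j))"
  unfolding factorial_measure_mset factorial_measure_list_def injections_def[symmetric]
  unfolding integral_distr[OF tuples_in_space[OF xs] f]
  by (simp add: lebesgue_integral_count_space_finite finite_injections)

lemma sets_factorial_measure [simp]:
  "sets (factorial_measure n \<eta>) = sets (PiM {1..n} (\<lambda>_. unit_lebesgue))"
  by (simp add: factorial_measure_def factorial_measure_list_def)

lemma finite_measure_factorial_measure:
  assumes "set_mset \<eta> \<subseteq> {0<..<1}"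
  shows "finite_measure (factorial_measure n \<eta>)"
proof -
  obtain xs where xs: "\<eta> = mset xs" by (metis ex_mset)
  have "finite_measure (count_space (injections {1..n} (length xs)))"
    by (rule finite_measure_count_space[OF finite_injections]) simp
  moreover have "set xs \<subseteq> {0<..<1}" using assms xs by simp
  ultimately show ?thesis
    unfolding xs factorial_measure_mset factorial_measure_list_def injections_def[symmetric]
    by (rule finite_measure.finite_measure_distr[OF _ tuples_in_space])
qed

lemma emeasure_factorial_measure_PiE:
  assumes xs: "set xs \<subseteq> {0<..<1}" and A: "\<And>j. j \<in> {1..n} \<Longrightarrow> A j \<in> sets unit_lebesgue"
  shows "emeasure (factorial_measure n (mset xs)) (PiE {1..n} A) =
    inj_sum {1..n} xs (\<lambda>j. indicator (A j))"
proof -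
  let ?C = "count_space (injections {1..n} (length xs))"
  have "emeasure (factorial_measure n (mset xs)) (PiE {1..n} A) =
      (\<integral>\<^sup>+y. indicator (PiE {1..n} A) y \<partial>factorial_measure n (mset xs))"
    using A by (intro nn_integral_indicator[symmetric]) (auto intro!: sets_PiM_I_finite)
  also have "\<dots> = (\<integral>\<^sup>+i. indicator (PiE {1..n} A) (\<lambda>j\<in>{1..n}. xs ! i j) \<partial>?C)"
    unfolding factorial_measure_mset factorial_measure_list_def injections_def[symmetric]
    using A by (intro nn_integral_distr tuples_in_space[OF xs]) (auto intro!: borel_measurable_indicator sets_PiM_I_finite)
  also have "\<dots> = (\<Sum>i\<in>injections {1..n} (length xs). indicator (PiE {1..n} A) (\<lambda>j\<in>{1..n}. xs ! i j))"
    by (rule nn_integral_count_space_finite[OF finite_injections]) simp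
  also have "\<dots> = inj_sum {1..n} xs (\<lambda>j. indicator (A j))"
    unfolding inj_sum_def
  proof (intro sum.cong refl)
    fix i
    have "(\<Prod>j\<in>{1..n}. indicator (A j) (xs ! i j)) = (of_bool (\<forall>j\<in>{1..n}. xs ! i j \<in> A j) :: ennreal)"
      by (auto simp: indicator_def intro!: prod_zero)
    then show "indicator (PiE {1..n} A) (\<lambda>j\<in>{1..n}. xs ! i j) = (\<Prod>j\<in>{1..n}. indicator (A j) (xs ! i j) :: ennreal)"
      by (simp add: indicator_def PiE_iff)
  qed
  finally show ?thesis .
qed

text \<open>Positions are numbered from 1 and list entries from 0, hence the shift.\<close>

lemma bij_betw_sorted_list_of_set:
  assumes "finite J"
  shows "bij_betw (\<lambda>j. sorted_list_of_set J ! (j - 1)) {1..card J} J"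
proof -
  have "bij_betw (\<lambda>j. j - 1) {1..card J} {..<card J}"
    by (rule bij_betwI[where g = Suc]) auto
  moreover have "bij_betw ((!) (sorted_list_of_set J)) {..<card J} J"
    using assms by (intro bij_betw_nth) auto
  ultimately have "bij_betw ((!) (sorted_list_of_set J) \<circ> (\<lambda>j. j - 1)) {1..card J} J"
    by (rule bij_betw_trans)
  then show ?thesis by (simp add: comp_def)
qed

text \<open>Products and sums over injections do not depend on how positions are numbered, so the
  increasing enumeration in \<open>subtuple\<close> can be undone in both factors. Coordinates of
  \<open>z\<close> in the open interval make the integrand measurable.\<close>

lemma moment_density_eq:
  assumes V: "wiener_measure V" and p: "transition_density V p" and t: "0 < t"
    and xs: "set xs \<subseteq> {0<..<1}" and z: "\<And>j. j \<in> {1..n} \<Longrightarrow> z j \<in> {0<..<1}"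
  shows "moment_density V p lam\<^sub>L lam\<^sub>R (mset xs) t n z =
    (\<Sum>I\<in>Pow {1..n}. (\<Prod>j\<in>I. gas_intensity V lam\<^sub>L lam\<^sub>R t (z j)) *
      inj_sum ({1..n} - I) xs (\<lambda>j. p t (z j)))"
  unfolding moment_density_def
proof (intro sum.cong refl arg_cong2[where f = "(*)"])
  fix I assume I: "I \<in> Pow {1..n}"
  let ?s = "\<lambda>J j. sorted_list_of_set J ! (j - 1)"
  have fin: "finite I" using I finite_subset by auto
  have "(\<Prod>i\<in>{1..card I}. gas_intensity V lam\<^sub>L lam\<^sub>R t (subtuple z I i)) =
      (\<Prod>i\<in>{1..card I}. gas_intensity V lam\<^sub>L lam\<^sub>R t (z (?s I i)))"
    by (intro prod.cong) (auto simp: subtuple_def)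
  also have "\<dots> = (\<Prod>j\<in>I. gas_intensity V lam\<^sub>L lam\<^sub>R t (z j))"
    by (rule prod.reindex_bij_betw[OF bij_betw_sorted_list_of_set[OF fin]])
  finally show "abs_expectation V (card I) (subtuple z I)
      (\<lambda>\<xi>. lam\<^sub>L ^ num_points (\<xi> t) {0} * lam\<^sub>R ^ num_points (\<xi> t) {1} *
        of_bool (num_points (\<xi> t) {0, 1} = card I)) =
      (\<Prod>j\<in>I. gas_intensity V lam\<^sub>L lam\<^sub>R t (z j))"
    using t by (simp add: abs_expectation_boundary_weight[OF V])
  let ?K = "{1..n} - I"
  have card: "n - card I = card ?K"
    using I fin by (simp add: card_Diff_subset)
  have bij: "bij_betw (?s ?K) {1..card ?K} ?K"
    by (rule bij_betw_sorted_list_of_set) simp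
  have sub: "subtuple z ?K j = z (?s ?K j)" "subtuple z ?K j \<in> {0<..<1}" if "j \<in> {1..card ?K}" for j
    using that bij_betwE[OF bij] z by (auto simp: subtuple_def)
  have "(\<integral>y. (\<Prod>j\<in>{1..n - card I}. p t (subtuple z ?K j) (y j)) \<partial>factorial_measure (n - card I) (mset xs)) =
      (\<Sum>i\<in>injections {1..card ?K} (length xs). \<Prod>j\<in>{1..card ?K}. p t (subtuple z ?K j) ((\<lambda>j\<in>{1..card ?K}. xs ! i j) j))"
    unfolding card
  proof (rule integral_factorial_measure[OF xs], rule borel_measurable_prod)
    fix j assume j: "j \<in> {1..card ?K}"
    have "p t (subtuple z ?K j) \<in> borel_measurable unit_lebesgue"
      using p t sub(2)[OF j] by (intro measurable_unit_lebesgue) (auto simp: transition_density_def)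
    then show "(\<lambda>y. p t (subtuple z ?K j) (y j)) \<in> borel_measurable (PiM {1..card ?K} (\<lambda>_. unit_lebesgue))"
      by (rule measurable_compose[OF measurable_component_singleton[OF j]])
  qed
  also have "\<dots> = inj_sum {1..card ?K} xs (\<lambda>j. p t (z (?s ?K j)))"
    unfolding inj_sum_def by (intro sum.cong prod.cong refl) (simp only: sub restrict_apply' if_True)
  also have "\<dots> = inj_sum ?K xs (\<lambda>j. p t (z j))"
    by (rule inj_sum_reindex[OF bij, where f = "\<lambda>j. p t (z j)"]) simp
  finally show "(\<integral>y. (\<Prod>j\<in>{1..n - card I}. p t (subtuple z ?K j) (y j)) \<partial>factorial_measure (n - card I) (mset xs)) =
      inj_sum ?K xs (\<lambda>j. p t (z j))" .
qed

text \<open>Tonelli: for a fixed \<open>I\<close> and a fixed injection, the integrand is a product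
  of functions of one coordinate each.\<close>

lemma nn_integral_product_inj_sum:
  fixes G :: "'a \<Rightarrow> ennreal" and Q :: "'a \<Rightarrow> 'u \<Rightarrow> ennreal"
  assumes M: "sigma_finite_measure M" and J: "finite J"
    and A [measurable]: "\<And>j. j \<in> J \<Longrightarrow> A j \<in> sets M"
    and G [measurable]: "G \<in> borel_measurable M"
    and Q: "\<And>u. u \<in> set xs \<Longrightarrow> (\<lambda>z. Q z u) \<in> borel_measurable M"
  shows "(\<integral>\<^sup>+z. (\<Sum>I\<in>Pow J. (\<Prod>j\<in>I. G (z j)) * inj_sum (J - I) xs (\<lambda>j. Q (z j))) *
      (\<Prod>j\<in>J. indicator (A j) (z j)) \<partial>PiM J (\<lambda>_. M)) =
    (\<Sum>I\<in>Pow J. (\<Prod>j\<in>I. \<integral>\<^sup>+z\<in>A j. G z \<partial>M) * inj_sum (J - I) xs (\<lambda>j u. \<integral>\<^sup>+z\<in>A j. Q z u \<partial>M))"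
proof -
  interpret product_sigma_finite "\<lambda>_. M"
    using M by (simp add: product_sigma_finite_def)
  \<comment> \<open>All that depends on coordinate \<open>j\<close>: the Poisson or the particle
    factor, and the side of the rectangle.\<close>
  define \<phi> where "\<phi> = (\<lambda>I i j z. (if j \<in> I then G z else Q z (xs ! i j)) * indicator (A j) z)"
  have split: "(\<Prod>j\<in>I. a j) * (\<Prod>j\<in>J - I. b j) = (\<Prod>j\<in>J. if j \<in> I then a j else b j)"
    if "I \<in> Pow J" for I and a b :: "_ \<Rightarrow> ennreal"
  proof -
    have "{j \<in> J. j \<in> I} = I" "{j \<in> J. j \<notin> I} = J - I" using that by auto
    then show ?thesis using J by (simp add: prod.If_cases Int_def Diff_eq Compl_eq)
  qed
  have \<phi>: "\<phi> I i j \<in> borel_measurable M" if "j \<in> J" "I \<in> Pow J" "i \<in> injections (J - I) (length xs)" for I i j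
  proof -
    have "j \<notin> I \<Longrightarrow> xs ! i j \<in> set xs"
      using injections_mem[OF that(3)] that(1) by simp
    then show ?thesis
      unfolding \<phi>_def using A[OF that(1)] G Q by (cases "j \<in> I") auto
  qed
  have meas: "(\<lambda>z. \<Prod>j\<in>J. \<phi> I i j (z j)) \<in> borel_measurable (PiM J (\<lambda>_. M))"
    if "I \<in> Pow J" "i \<in> injections (J - I) (length xs)" for I i
  proof (rule borel_measurable_prod_ennreal)
    fix j assume j: "j \<in> J"
    show "(\<lambda>z. \<phi> I i j (z j)) \<in> borel_measurable (PiM J (\<lambda>_. M))"
      by (rule measurable_compose[OF measurable_component_singleton[OF j] \<phi>[OF j that]])
  qed
  have "(\<integral>\<^sup>+z. (\<Sum>I\<in>Pow J. (\<Prod>j\<in>I. G (z j)) * inj_sum (J - I) xs (\<lambda>j. Q (z j))) *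
      (\<Prod>j\<in>J. indicator (A j) (z j)) \<partial>PiM J (\<lambda>_. M)) =
      (\<integral>\<^sup>+z. (\<Sum>I\<in>Pow J. \<Sum>i\<in>injections (J - I) (length xs). \<Prod>j\<in>J. \<phi> I i j (z j)) \<partial>PiM J (\<lambda>_. M))"
    unfolding \<phi>_def inj_sum_def sum_distrib_left sum_distrib_right
    by (intro nn_integral_cong sum.cong refl) (simp only: split prod.distrib)
  also have "\<dots> = (\<Sum>I\<in>Pow J. \<integral>\<^sup>+z. (\<Sum>i\<in>injections (J - I) (length xs). \<Prod>j\<in>J. \<phi> I i j (z j)) \<partial>PiM J (\<lambda>_. M))"
    by (intro nn_integral_sum borel_measurable_sum meas)
  also have "\<dots> = (\<Sum>I\<in>Pow J. \<Sum>i\<in>injections (J - I) (length xs). \<integral>\<^sup>+z. (\<Prod>j\<in>J. \<phi> I i j (z j)) \<partial>PiM J (\<lambda>_. M))"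
    by (intro sum.cong refl nn_integral_sum meas)
  also have "\<dots> = (\<Sum>I\<in>Pow J. \<Sum>i\<in>injections (J - I) (length xs). \<Prod>j\<in>J. \<integral>\<^sup>+z. \<phi> I i j z \<partial>M)"
    by (intro sum.cong refl product_nn_integral_prod J \<phi>)
  also have "\<dots> = (\<Sum>I\<in>Pow J. \<Sum>i\<in>injections (J - I) (length xs).
      (\<Prod>j\<in>I. \<integral>\<^sup>+z\<in>A j. G z \<partial>M) * (\<Prod>j\<in>J - I. \<integral>\<^sup>+z\<in>A j. Q z (xs ! i j) \<partial>M))"
    by (intro sum.cong refl) (simp only: split, auto simp: \<phi>_def intro!: prod.cong)
  finally show ?thesis
    by (simp add: inj_sum_def sum_distrib_left)
qed

text \<open>Distinct positions pick distinct labels, so every product has independent factors. The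
  list holds labels because several particles may start at the same point.\<close>

lemma (in prob_space) expectation_inj_sum:
  assumes indep: "indep_vars (\<lambda>_. N) X (set ks)" and ks: "distinct ks"
    and J: "finite J" and f: "\<And>j. j \<in> J \<Longrightarrow> f j \<in> borel_measurable N"
  shows "(\<integral>\<^sup>+\<omega>. inj_sum J ks (\<lambda>j k. f j (X k \<omega>)) \<partial>M) =
    (inj_sum J ks (\<lambda>j k. \<integral>\<^sup>+\<omega>. f j (X k \<omega>) \<partial>M) :: ennreal)"
proof -
  have X: "X k \<in> measurable M N" if "k \<in> set ks" for k
    using indep that by (auto simp: indep_vars_def)
  have "(\<integral>\<^sup>+\<omega>. inj_sum J ks (\<lambda>j k. f j (X k \<omega>)) \<partial>M) =
      (\<Sum>i\<in>injections J (length ks). \<integral>\<^sup>+\<omega>. (\<Prod>j\<in>J. f j (X (ks ! i j) \<omega>)) \<partial>M)"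
    unfolding inj_sum_def
    by (intro nn_integral_sum borel_measurable_prod_ennreal measurable_compose[OF X f])
       (auto dest: injections_mem)
  also have "\<dots> = inj_sum J ks (\<lambda>j k. \<integral>\<^sup>+\<omega>. f j (X k \<omega>) \<partial>M)"
    unfolding inj_sum_def
  proof (intro sum.cong refl)
    fix i assume i: "i \<in> injections J (length ks)"
    define \<kappa> where "\<kappa> = (\<lambda>j. ks ! i j)"
    have mem: "\<kappa> j \<in> set ks" if "j \<in> J" for j
      using injections_mem[OF i that] by (simp add: \<kappa>_def)
    have inj: "inj_on \<kappa> J"
      using i ks injections_mem[OF i] by (auto simp: \<kappa>_def inj_on_def injections_def nth_eq_iff_index_eq)
    \<comment> \<open>Independence is indexed by labels; \<open>inv_into\<close> recovers the
      position that picked a label.\<close>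
    have "indep_vars (\<lambda>_. borel) (\<lambda>k \<omega>. f (inv_into J \<kappa> k) (X k \<omega>)) (\<kappa> ` J)"
      by (rule indep_vars_compose2[OF indep_vars_subset[OF indep]])
         (use mem inj f in \<open>auto\<close>)
    then have "(\<integral>\<^sup>+\<omega>. (\<Prod>k\<in>\<kappa> ` J. f (inv_into J \<kappa> k) (X k \<omega>)) \<partial>M) =
        (\<Prod>k\<in>\<kappa> ` J. \<integral>\<^sup>+\<omega>. f (inv_into J \<kappa> k) (X k \<omega>) \<partial>M)"
      by (intro indep_vars_nn_integral) (use J in auto)
    then have "(\<integral>\<^sup>+\<omega>. (\<Prod>j\<in>J. f j (X (\<kappa> j) \<omega>)) \<partial>M) = (\<Prod>j\<in>J. \<integral>\<^sup>+\<omega>. f j (X (\<kappa> j) \<omega>) \<partial>M)"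
      unfolding prod.reindex[OF inj] using inj by (simp cong: prod.cong)
    then show "(\<integral>\<^sup>+\<omega>. (\<Prod>j\<in>J. f j (X (ks ! i j) \<omega>)) \<partial>M) = (\<Prod>j\<in>J. \<integral>\<^sup>+\<omega>. f j (X (ks ! i j) \<omega>) \<partial>M)"
      by (simp add: \<kappa>_def)
  qed
  finally show ?thesis .
qed

section \<open>The factorial moment measure\<close>

text \<open>A measure given by \<open>measure_of\<close> has the intended values only once the set
  function is known to be countably additive, and this requires every set to have a measure
  depending measurably on \<omega>. A Dynkin argument derives that from rectangles; its complement
  step uses that the random measures are finite.\<close>

lemma factorial_moment_measure_eqI:
  fixes P :: "'w measure"
  assumes X: "\<And>\<omega>. \<omega> \<in> space P \<Longrightarrow> set_mset (X \<omega>) \<subseteq> {0<..<1}"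
    and meas: "\<And>A. (\<And>j. j \<in> {1..n} \<Longrightarrow> A j \<in> sets unit_lebesgue) \<Longrightarrow>
      (\<lambda>\<omega>. emeasure (factorial_measure n (X \<omega>)) (PiE {1..n} A)) \<in> borel_measurable P"
    and Q: "sets Q = sets (PiM {1..n} (\<lambda>_. unit_lebesgue))"
    and eq: "\<And>A. (\<And>j. j \<in> {1..n} \<Longrightarrow> A j \<in> sets unit_lebesgue) \<Longrightarrow>
      (\<integral>\<^sup>+\<omega>. emeasure (factorial_measure n (X \<omega>)) (PiE {1..n} A) \<partial>P) = emeasure Q (PiE {1..n} A)"
    and fin: "emeasure Q (space Q) \<noteq> \<infinity>"
  shows "factorial_moment_measure P n X = Q"
proof -
  let ?R = "PiM {1..n} (\<lambda>_. unit_lebesgue)"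
  let ?F = "\<lambda>\<omega>. factorial_measure n (X \<omega>)"
  let ?K = "\<lambda>A. \<integral>\<^sup>+\<omega>. emeasure (?F \<omega>) A \<partial>P"
  have space_F: "space (?F \<omega>) = space ?R" for \<omega>
    by (rule sets_eq_imp_space_eq) simp
  have meas': "(\<lambda>\<omega>. emeasure (?F \<omega>) A) \<in> borel_measurable P" if "A \<in> sets ?R" for A
  proof -
    have "A \<in> sigma_sets (space ?R) (prod_algebra {1..n} (\<lambda>_. unit_lebesgue))"
      using that by (simp add: sets_PiM space_PiM)
    with Int_stable_prod_algebra prod_algebra_sets_into_space[of "{1..n}" "\<lambda>_. unit_lebesgue", folded space_PiM]
    show ?thesis
    proof (induction rule: sigma_sets_induct_disjoint)
      case (basic A)
      then obtain B where "A = PiE {1..n} B" "\<And>j. j \<in> {1..n} \<Longrightarrow> B j \<in> sets unit_lebesgue"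
        unfolding prod_algebra_eq_finite[OF finite_atLeastAtMost] by blast
      then show ?case using meas by simp
    next
      case empty
      then show ?case by simp
    next
      case (compl A)
      have A: "A \<in> sets ?R" using compl(1) by (simp add: sets_PiM space_PiM)
      have "space ?R = PiE {1..n} (\<lambda>_. {0<..<1})" by (simp add: space_PiM)
      then have "(\<lambda>\<omega>. emeasure (?F \<omega>) (space ?R)) \<in> borel_measurable P"
        using meas[of "\<lambda>_. {0<..<1}"] by (simp add: sets_unit_lebesgue)
      then have "(\<lambda>\<omega>. emeasure (?F \<omega>) (space ?R) - emeasure (?F \<omega>) A) \<in> borel_measurable P"
        using compl(2) by measurable
      moreover have "emeasure (?F \<omega>) (space ?R - A) = emeasure (?F \<omega>) (space ?R) - emeasure (?F \<omega>) A"
        if "\<omega> \<in> space P" for \<omega>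
      proof -
        interpret finite_measure "?F \<omega>"
          by (rule finite_measure_factorial_measure[OF X[OF that]])
        show ?thesis
          using emeasure_compl[of A "?F \<omega>"] A by (simp add: space_F)
      qed
      ultimately show ?case
        by (simp cong: measurable_cong)
    next
      case (union A)
      have "range A \<subseteq> sets ?R" using union(2) by (simp add: sets_PiM space_PiM)
      then have "emeasure (?F \<omega>) (\<Union>i. A i) = (\<Sum>i. emeasure (?F \<omega>) (A i))" for \<omega>
        using union(1) by (intro suminf_emeasure[symmetric]) auto
      then show ?case using union(3) by simp
    qed
  qed
  have emeasure: "emeasure (factorial_moment_measure P n X) A = ?K A" if "A \<in> sets ?R" for A
    unfolding factorial_moment_measure_def
  proof (rule emeasure_measure_of_sigma[OF sets.sigma_algebra_axioms _ _ that])
    show "positive (sets ?R) ?K" by (simp add: positive_def)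
    show "countably_additive (sets ?R) ?K"
    proof (rule countably_additiveI)
      fix A :: "nat \<Rightarrow> _" assume A: "range A \<subseteq> sets ?R" "disjoint_family A"
      have "(\<Sum>i. ?K (A i)) = (\<integral>\<^sup>+\<omega>. (\<Sum>i. emeasure (?F \<omega>) (A i)) \<partial>P)"
        using A by (intro nn_integral_suminf[symmetric] meas') auto
      also have "\<dots> = ?K (\<Union>i. A i)"
        using A by (intro nn_integral_cong suminf_emeasure) auto
      finally show "(\<Sum>i. ?K (A i)) = ?K (\<Union>i. A i)" .
    qed
  qed
  have sets: "sets (factorial_moment_measure P n X) = sets ?R"
    by (simp add: factorial_moment_measure_def)
  show ?thesis
  proof (rule measure_eqI_PiM_finite[OF _ sets Q])
    show rect: "emeasure (factorial_moment_measure P n X) (PiE {1..n} A) = emeasure Q (PiE {1..n} A)"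
      if "\<And>j. j \<in> {1..n} \<Longrightarrow> A j \<in> sets unit_lebesgue" for A
      using emeasure[OF sets_PiM_I_finite[OF finite_atLeastAtMost that]] eq[OF that] by simp
    have space: "space ?R = PiE {1..n} (\<lambda>_. {0<..<1})" by (simp add: space_PiM)
    \<comment> \<open>The total mass is finite, so a constant sequence serves as exhaustion.\<close>
    show "range (\<lambda>_::nat. space ?R) \<subseteq> prod_algebra {1..n} (\<lambda>_. unit_lebesgue)"
      unfolding space by (auto simp: sets_unit_lebesgue intro!: prod_algebraI_finite)
    have "emeasure (factorial_moment_measure P n X) (space ?R) = emeasure Q (space Q)"
      unfolding sets_eq_imp_space_eq[OF Q] unfolding space
      by (rule rect) (simp add: sets_unit_lebesgue)
    then show "emeasure (factorial_moment_measure P n X) (space ?R) \<noteq> \<infinity>" for i :: nat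
      using fin by simp
  qed simp_all
qed

lemma (in prob_space) indep_var_nn_integral:
  fixes X Y :: "'a \<Rightarrow> ennreal"
  assumes "indep_var borel X borel Y"
  shows "(\<integral>\<^sup>+\<omega>. X \<omega> * Y \<omega> \<partial>M) = (\<integral>\<^sup>+\<omega>. X \<omega> \<partial>M) * (\<integral>\<^sup>+\<omega>. Y \<omega> \<partial>M)"
proof -
  have "case_bool borel borel = (\<lambda>_. borel :: ennreal measure)"
    by (auto simp: fun_eq_iff split: bool.split)
  then have "indep_vars (\<lambda>_. borel) (case_bool X Y) UNIV"
    using assms unfolding indep_var_def by (simp only:)
  then have "(\<integral>\<^sup>+\<omega>. (\<Prod>b\<in>UNIV. case_bool X Y b \<omega>) \<partial>M) = (\<Prod>b\<in>UNIV. \<integral>\<^sup>+\<omega>. case_bool X Y b \<omega> \<partial>M)"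
    by (intro indep_vars_nn_integral) auto
  then show ?thesis by (simp add: UNIV_bool mult.commute)
qed

lemma inj_sum_neq_top:
  fixes f :: "'j \<Rightarrow> 'a \<Rightarrow> ennreal"
  assumes "finite J" "\<And>j x. j \<in> J \<Longrightarrow> x \<in> set xs \<Longrightarrow> f j x \<noteq> \<top>"
  shows "inj_sum J xs f \<noteq> \<top>"
  unfolding inj_sum_def using assms
  by (auto simp: finite_injections ennreal_prod_eq_top dest: injections_mem)

lemma ennreal_inj_sum:
  fixes f :: "'j \<Rightarrow> 'a \<Rightarrow> real"
  assumes "\<And>j x. j \<in> J \<Longrightarrow> x \<in> set xs \<Longrightarrow> 0 \<le> f j x"
  shows "ennreal (inj_sum J xs f) = inj_sum J xs (\<lambda>j x. ennreal (f j x))"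
    and "0 \<le> inj_sum J xs f"
proof -
  have nonneg: "0 \<le> f j (xs ! i j)" if "i \<in> injections J (length xs)" "j \<in> J" for i j
    using assms that by (auto dest: injections_mem)
  then show "0 \<le> inj_sum J xs f"
    unfolding inj_sum_def by (intro sum_nonneg prod_nonneg)
  show "ennreal (inj_sum J xs f) = inj_sum J xs (\<lambda>j x. ennreal (f j x))"
    unfolding inj_sum_def using nonneg
    by (subst sum_ennreal[symmetric]) (auto intro!: prod_nonneg sum.cong simp: prod_ennreal)
qed

lemma emeasure_abs_law_interior:
  assumes V: "wiener_measure V" and p: "transition_density V p" and t: "0 < t"
    and u: "u \<in> {0<..<1}" and A: "A \<in> sets unit_lebesgue"
  shows "(\<integral>\<^sup>+w. indicator A (w t) \<partial>abs_law V u) = (\<integral>\<^sup>+z\<in>A. ennreal (p t z u) \<partial>unit_lebesgue)"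
proof -
  have A': "A \<in> sets borel" "A \<subseteq> {0<..<1}" using A by (auto simp: sets_unit_lebesgue)
  have comp: "(\<lambda>w. w t) \<in> borel_measurable (abs_law V u)"
    using measurable_path_component[of t] t by (simp add: measurable_cong_sets[OF sets_abs_law[OF V] refl])
  have "(\<integral>\<^sup>+w. indicator A (w t) \<partial>abs_law V u) = (\<integral>\<^sup>+y. indicator A y \<partial>transition_prob V t u)"
    unfolding transition_prob_def using A' by (intro nn_integral_distr[symmetric] comp) simp
  also have "\<dots> = emeasure (transition_prob V t u) A"
    using A' by (intro nn_integral_indicator) (simp add: transition_prob_def)
  also have "\<dots> = (\<integral>\<^sup>+y\<in>A. ennreal (p t u y) \<partial>lborel)"
    using p t u A' unfolding transition_density_def by blast
  also have "\<dots> = (\<integral>\<^sup>+z. ennreal (p t u z) * indicator A z \<partial>unit_lebesgue)"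
    unfolding unit_lebesgue_def
    using A'(2) by (subst nn_integral_restrict_space) (auto intro!: nn_integral_cong split: split_indicator)
  also have "\<dots> = (\<integral>\<^sup>+z\<in>A. ennreal (p t z u) \<partial>unit_lebesgue)"
  proof (intro nn_integral_cong)
    fix z assume "z \<in> space unit_lebesgue"
    then have "p t u z = p t z u"
      using p t u unfolding transition_density_def space_unit_lebesgue by blast
    then show "ennreal (p t u z) * indicator A z = ennreal (p t z u) * indicator A z" by simp
  qed
  finally show ?thesis .
qed

text \<open>Measurability is assumed in the second argument; symmetry transfers it to the
  first.\<close>

lemma measurable_transition_density:
  assumes p: "transition_density V p" and t: "0 < t" and u: "u \<in> {0<..<1}"
  shows "(\<lambda>z. p t z u) \<in> borel_measurable unit_lebesgue"
proof -
  have "p t u \<in> borel_measurable unit_lebesgue"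
    using p t u by (intro measurable_unit_lebesgue) (simp add: transition_density_def)
  moreover have "p t z u = p t u z" if "z \<in> space unit_lebesgue" for z
    using p t u that unfolding transition_density_def space_unit_lebesgue by blast
  ultimately show ?thesis by (rule measurable_cong[THEN iffD2, rotated])
qed

lemma mset_map_upt: "mset (map y [1..<Suc N]) = config_of N y"
  by (simp add: config_of_def atLeastLessThanSuc_atLeastAtMost del: upt_Suc)

text \<open>Measurability belongs to the claim, since \<open>density\<close> is meaningful only for
  measurable functions. In \<open>absolutely_continuous\<close> the reference measure comes
  first.\<close>

theorem theorem4p1:
  fixes V :: "(real \<Rightarrow> real) measure"
    and p :: "real \<Rightarrow> real \<Rightarrow> real \<Rightarrow> real"
    and lam\<^sub>L lam\<^sub>R t :: real
    and N n :: nat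
    and x :: "nat \<Rightarrow> real"
    and \<eta> :: "real multiset"
    and P :: "'w measure"
    and H :: "real \<Rightarrow> 'w \<Rightarrow> real multiset"
  assumes "wiener_measure V"
    and "transition_density V p"
    and "0 \<le> lam\<^sub>L" and "0 \<le> lam\<^sub>R"
    and "\<forall>i\<in>{1..N}. x i \<in> {0<..<1}"
    and "\<eta> = config_of N x"
    and "boundary_driven_gas V lam\<^sub>L lam\<^sub>R N x P H"
    and "0 < t"
  shows "moment_density V p lam\<^sub>L lam\<^sub>R \<eta> t n \<in> borel_measurable (PiM {1..n} (\<lambda>_. unit_lebesgue)) \<and>
         absolutely_continuous (PiM {1..n} (\<lambda>_. unit_lebesgue)) (factorial_moment_measure P n (H t)) \<and>
         factorial_moment_measure P n (H t) =
           density (PiM {1..n} (\<lambda>_. unit_lebesgue))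
             (\<lambda>z. ennreal (moment_density V p lam\<^sub>L lam\<^sub>R \<eta> t n z))"
proof -
  note V = assms(1) and p = assms(2) and t = assms(8)
  let ?J = "{1..n}" and ?U = "{0<..<1::real}" and ?R = "PiM {1..n} (\<lambda>_. unit_lebesgue)"
  let ?g = "gas_intensity V lam\<^sub>L lam\<^sub>R t"
  let ?ks = "[1..<Suc N]"
  define xs where "xs = map x ?ks"
  define \<mu> where "\<mu> = density unit_lebesgue (\<lambda>u. ennreal (?g u))"
  define D where "D = moment_density V p lam\<^sub>L lam\<^sub>R \<eta> t n"
  have \<eta>: "\<eta> = mset xs" unfolding xs_def mset_map_upt assms(6) ..
  have ks: "set ?ks = {1..N}" by auto
  have xs: "set xs \<subseteq> ?U" unfolding xs_def set_map ks using assms(5) by auto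
  have p_nonneg: "0 \<le> p t z u" if "z \<in> ?U" "u \<in> ?U" for z u
    using p t that by (simp add: transition_density_def)
  have g_nonneg: "0 \<le> ?g z" for z
    using assms(3,4) by (rule gas_intensity_nonneg)
  have g [measurable]: "?g \<in> borel_measurable unit_lebesgue"
    using borel_measurable_gas_intensity[OF V] t by (intro measurable_unit_lebesgue) simp
  have pu: "(\<lambda>z. p t z u) \<in> borel_measurable unit_lebesgue" if "u \<in> set xs" for u
    using measurable_transition_density[OF p t] xs that by blast
  have space_R: "space ?R = PiE ?J (\<lambda>_. ?U)" by (simp add: space_PiM)

  \<comment> \<open>Closed form of the density and its measurability\<close>
  have z_U: "z j \<in> ?U" if "z \<in> space ?R" "j \<in> ?J" for z j
    using that unfolding space_R by (rule PiE_mem)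
  have D_eq: "D z = (\<Sum>I\<in>Pow ?J. (\<Prod>j\<in>I. ?g (z j)) * inj_sum (?J - I) xs (\<lambda>j. p t (z j)))"
    if "z \<in> space ?R" for z
    unfolding D_def \<eta> by (rule moment_density_eq[OF V p t xs]) (rule z_U[OF that])
  have comp: "(\<lambda>z. f (z j)) \<in> borel_measurable ?R" if "f \<in> borel_measurable unit_lebesgue" "j \<in> ?J"
    for f :: "real \<Rightarrow> real" and j
    by (rule measurable_compose[OF measurable_component_singleton[OF that(2)] that(1)])
  have "(\<lambda>z. \<Sum>I\<in>Pow ?J. (\<Prod>j\<in>I. ?g (z j)) * inj_sum (?J - I) xs (\<lambda>j. p t (z j))) \<in> borel_measurable ?R"
    unfolding inj_sum_def
  proof (intro borel_measurable_sum borel_measurable_times borel_measurable_prod)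
    fix I j assume "I \<in> Pow ?J" "j \<in> I"
    then show "(\<lambda>z. ?g (z j)) \<in> borel_measurable ?R" by (intro comp[OF g]) auto
  next
    fix I i j assume "i \<in> injections (?J - I) (length xs)" "j \<in> ?J - I"
    then show "(\<lambda>z. p t (z j) (xs ! i j)) \<in> borel_measurable ?R"
      by (intro comp[OF pu]) (auto dest: injections_mem)
  qed
  then have D_meas: "D \<in> borel_measurable ?R"
    by (rule measurable_cong[THEN iffD1, rotated]) (rule D_eq[symmetric])

  \<comment> \<open>Integral of the density over a rectangle\<close>
  have density_rect: "emeasure (density ?R (\<lambda>z. ennreal (D z))) (PiE ?J A) =
      (\<Sum>I\<in>Pow ?J. (\<Prod>j\<in>I. emeasure \<mu> (A j)) *
        inj_sum (?J - I) xs (\<lambda>j u. \<integral>\<^sup>+z\<in>A j. ennreal (p t z u) \<partial>unit_lebesgue))"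
    if A: "\<And>j. j \<in> ?J \<Longrightarrow> A j \<in> sets unit_lebesgue" for A
  proof -
    have "emeasure (density ?R (\<lambda>z. ennreal (D z))) (PiE ?J A) =
        (\<integral>\<^sup>+z. ennreal (D z) * indicator (PiE ?J A) z \<partial>?R)"
      using D_meas A by (intro emeasure_density) (auto intro!: sets_PiM_I_finite)
    also have "\<dots> = (\<integral>\<^sup>+z. (\<Sum>I\<in>Pow ?J. (\<Prod>j\<in>I. ennreal (?g (z j))) *
        inj_sum (?J - I) xs (\<lambda>j u. ennreal (p t (z j) u))) * (\<Prod>j\<in>?J. indicator (A j) (z j)) \<partial>?R)"
    proof (intro nn_integral_cong arg_cong2[where f = "(*)"])
      fix z assume z: "z \<in> space ?R"
      have pz: "0 \<le> p t (z j) u" if "j \<in> ?J - I" "u \<in> set xs" for I j u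
        using that(2) xs by (intro p_nonneg z_U[OF z]) (use that(1) in auto)
      note inj = ennreal_inj_sum[OF pz]
      show "ennreal (D z) = (\<Sum>I\<in>Pow ?J. (\<Prod>j\<in>I. ennreal (?g (z j))) *
          inj_sum (?J - I) xs (\<lambda>j u. ennreal (p t (z j) u)))"
      proof -
        have "ennreal (D z) = (\<Sum>I\<in>Pow ?J. ennreal ((\<Prod>j\<in>I. ?g (z j)) * inj_sum (?J - I) xs (\<lambda>j. p t (z j))))"
          unfolding D_eq[OF z]
          by (intro sum_ennreal[symmetric] mult_nonneg_nonneg prod_nonneg g_nonneg inj(2))
        also have "\<dots> = (\<Sum>I\<in>Pow ?J. (\<Prod>j\<in>I. ennreal (?g (z j))) *
            inj_sum (?J - I) xs (\<lambda>j u. ennreal (p t (z j) u)))"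
          by (intro sum.cong refl)
            (simp only: ennreal_mult[OF prod_nonneg inj(2)] inj(1) g_nonneg prod_ennreal)
        finally show ?thesis .
      qed
      have "z \<in> extensional ?J" using z unfolding space_R PiE_def by blast
      then have "z \<in> PiE ?J A \<longleftrightarrow> (\<forall>j\<in>?J. z j \<in> A j)" by (auto simp: PiE_iff)
      then show "indicator (PiE ?J A) z = (\<Prod>j\<in>?J. indicator (A j) (z j) :: ennreal)"
        by (auto simp: indicator_def intro!: prod_zero[symmetric])
    qed
    also have "\<dots> = (\<Sum>I\<in>Pow ?J. (\<Prod>j\<in>I. \<integral>\<^sup>+z\<in>A j. ennreal (?g z) \<partial>unit_lebesgue) *
        inj_sum (?J - I) xs (\<lambda>j u. \<integral>\<^sup>+z\<in>A j. ennreal (p t z u) \<partial>unit_lebesgue))"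
      by (rule nn_integral_product_inj_sum[OF sigma_finite_unit_lebesgue])
         (use A pu in auto)
    also have "\<dots> = (\<Sum>I\<in>Pow ?J. (\<Prod>j\<in>I. emeasure \<mu> (A j)) *
        inj_sum (?J - I) xs (\<lambda>j u. \<integral>\<^sup>+z\<in>A j. ennreal (p t z u) \<partial>unit_lebesgue))"
    proof (intro sum.cong refl arg_cong2[where f = "(*)"] prod.cong)
      fix I j assume "I \<in> Pow ?J" "j \<in> I"
      then have "A j \<in> sets unit_lebesgue" using A by auto
      then show "(\<integral>\<^sup>+z\<in>A j. ennreal (?g z) \<partial>unit_lebesgue) = emeasure \<mu> (A j)"
        unfolding \<mu>_def by (intro emeasure_density[symmetric]) auto
    qed
    finally show ?thesis .
  qed

  \<comment> \<open>The two parts of the gas at time \<open>t\<close>\<close>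
  have "prob_space P"
    using assms(7) by (simp add: boundary_driven_gas_def)
  then interpret prob_space P .
  obtain W \<Theta> where W: "indep_vars (\<lambda>_. path_space) W {1..N}"
    and W_law: "\<And>i. i \<in> {1..N} \<Longrightarrow> distr P path_space (W i) = abs_law V (x i)"
    and pois: "poisson_point_process P \<mu> (\<Theta> t)"
    and indep: "indep_var config_space (\<lambda>\<omega>. particle_config N (\<lambda>i. W i \<omega>) t) config_space (\<Theta> t)"
    and H: "\<And>\<omega>. \<omega> \<in> space P \<Longrightarrow>
      H t \<omega> = filter_mset (\<lambda>u. u \<in> ?U) (particle_config N (\<lambda>i. W i \<omega>) t) + \<Theta> t \<omega>"
    using assms(7) t unfolding boundary_driven_gas_def \<mu>_def by blast
  let ?\<xi> = "\<lambda>\<omega>. particle_config N (\<lambda>i. W i \<omega>) t"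
  let ?X = "\<lambda>i \<omega>. W i \<omega> t"
  have space_\<mu>: "space \<mu> = ?U" and sets_\<mu>: "sets \<mu> = sets unit_lebesgue"
    by (simp_all add: \<mu>_def)
  have \<mu>_fin: "emeasure \<mu> A \<noteq> \<top>" for A
    using pois finite_measure.emeasure_finite[of \<mu>] by (auto simp: poisson_point_process_def)
  have \<Theta>_sub: "set_mset (\<Theta> t \<omega>) \<subseteq> ?U" if "\<omega> \<in> space P" for \<omega>
    using pois that by (simp add: poisson_point_process_def space_\<mu>)
  have H_sub: "set_mset (H t \<omega>) \<subseteq> ?U" if "\<omega> \<in> space P" for \<omega>
    using H[OF that] \<Theta>_sub[OF that] by auto
  have W_meas: "W i \<in> measurable P path_space" if "i \<in> {1..N}" for i
    using W that by (simp add: indep_vars_def)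
  have indep_X: "indep_vars (\<lambda>_. borel) ?X (set ?ks)"
    unfolding ks using t by (intro indep_vars_compose2[OF W] measurable_path_component) simp
  have law: "(\<integral>\<^sup>+\<omega>. indicator A (?X k \<omega>) \<partial>P) = (\<integral>\<^sup>+z\<in>A. ennreal (p t z (x k)) \<partial>unit_lebesgue)"
    if k: "k \<in> {1..N}" and A: "A \<in> sets unit_lebesgue" for k A
  proof -
    have "(\<lambda>w. w t) \<in> borel_measurable path_space" "A \<in> sets borel"
      using t A by (auto simp: sets_unit_lebesgue)
    then have "(\<integral>\<^sup>+\<omega>. indicator A (?X k \<omega>) \<partial>P) = (\<integral>\<^sup>+w. indicator A (w t) \<partial>distr P path_space (W k))"
      by (subst nn_integral_distr[OF W_meas[OF k]]) auto
    also have "\<dots> = (\<integral>\<^sup>+z\<in>A. ennreal (p t z (x k)) \<partial>unit_lebesgue)"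
      unfolding W_law[OF k] using assms(5) k by (intro emeasure_abs_law_interior[OF V p t _ A]) simp
    finally show ?thesis .
  qed

  \<comment> \<open>Factorial measure of the gas on a rectangle\<close>
  have rect: "emeasure (factorial_measure n (H t \<omega>)) (PiE ?J A) =
      (\<Sum>I\<in>Pow ?J. factorial_count I A ?U (\<Theta> t \<omega>) * factorial_count (?J - I) A ?U (?\<xi> \<omega>))"
    if \<omega>: "\<omega> \<in> space P" and A: "\<And>j. j \<in> ?J \<Longrightarrow> A j \<in> sets unit_lebesgue" for \<omega> A
  proof -
    have A_sub: "A j \<subseteq> ?U" if "j \<in> ?J" for j
      using A[OF that] by (simp add: sets_unit_lebesgue)
    obtain ys where ys: "\<Theta> t \<omega> = mset ys" by (metis ex_mset)
    let ?zs = "map (\<lambda>i. W i \<omega> t) ?ks"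
    have zs: "?\<xi> \<omega> = mset ?zs"
      unfolding mset_map_upt particle_config_def ..
    \<comment> \<open>The Poisson points come last because \<open>I\<close> in
      \<open>inj_sum_append\<close> indexes the positions filled from the second list; it thus
      becomes the set \<open>I\<close> of the density formula.\<close>
    have H_list: "H t \<omega> = mset (filter (\<lambda>u. u \<in> ?U) ?zs @ ys)"
      unfolding H[OF \<omega>] ys zs by (simp only: mset_append mset_filter)
    have "emeasure (factorial_measure n (H t \<omega>)) (PiE ?J A) =
        inj_sum ?J (filter (\<lambda>u. u \<in> ?U) ?zs @ ys) (\<lambda>j. indicator (A j))"
      unfolding H_list using H_sub[OF \<omega>] A
      by (intro emeasure_factorial_measure_PiE) (simp_all only: H_list set_mset_mset)
    also have "\<dots> = (\<Sum>I\<in>Pow ?J. inj_sum I ys (\<lambda>j. indicator (A j)) *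
        inj_sum (?J - I) (filter (\<lambda>u. u \<in> ?U) ?zs) (\<lambda>j. indicator (A j)))"
      by (rule inj_sum_append) simp
    also have "\<dots> = (\<Sum>I\<in>Pow ?J. factorial_count I A ?U (\<Theta> t \<omega>) * factorial_count (?J - I) A ?U (?\<xi> \<omega>))"
    proof (intro sum.cong refl arg_cong2[where f = "(*)"])
      fix I assume I: "I \<in> Pow ?J"
      show "inj_sum I ys (\<lambda>j. indicator (A j)) = factorial_count I A ?U (\<Theta> t \<omega>)"
        unfolding ys using I by (intro inj_sum_indicator A_sub finite_subset[OF _ finite_atLeastAtMost]) blast+
      \<comment> \<open>The sets \<open>A j\<close> avoid the boundary, so absorbed particles may be
        put back. The result depends on \<xi> itself, for which independence is assumed.\<close>
      have "inj_sum (?J - I) (filter (\<lambda>u. u \<in> ?U) ?zs) (\<lambda>j. indicator (A j)) =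
          inj_sum (?J - I) ?zs (\<lambda>j. indicator (A j))"
        using A_sub by (intro inj_sum_filter) (fastforce simp: indicator_def simp del: One_nat_def)+
      also have "\<dots> = factorial_count (?J - I) A ?U (?\<xi> \<omega>)"
        unfolding zs by (intro inj_sum_indicator A_sub) simp_all
      finally show "inj_sum (?J - I) (filter (\<lambda>u. u \<in> ?U) ?zs) (\<lambda>j. indicator (A j)) =
          factorial_count (?J - I) A ?U (?\<xi> \<omega>)" .
    qed
    finally show ?thesis .
  qed
  have count_meas: "(factorial_count I A ?U :: _ \<Rightarrow> ennreal) \<in> borel_measurable config_space"
    if "I \<subseteq> ?J" and A: "\<And>j. j \<in> ?J \<Longrightarrow> A j \<in> sets unit_lebesgue" for I A
  proof (rule measurable_factorial_count)
    show "finite I" using that(1) finite_subset by blast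
    show "A j \<in> sets borel" if "j \<in> I" for j
      using A[of j] that \<open>I \<subseteq> ?J\<close> by (auto simp: sets_unit_lebesgue simp del: One_nat_def)
  qed simp
  note \<xi>_meas = indep_var_rv1[OF indep] and \<Theta>_meas = indep_var_rv2[OF indep]

  \<comment> \<open>Expectation of the factorial measure on a rectangle\<close>
  have moment_rect: "(\<integral>\<^sup>+\<omega>. emeasure (factorial_measure n (H t \<omega>)) (PiE ?J A) \<partial>P) =
      emeasure (density ?R (\<lambda>z. ennreal (D z))) (PiE ?J A)"
    if A: "\<And>j. j \<in> ?J \<Longrightarrow> A j \<in> sets unit_lebesgue" for A
  proof -
    note cm = count_meas[OF _ A]
    have "(\<integral>\<^sup>+\<omega>. emeasure (factorial_measure n (H t \<omega>)) (PiE ?J A) \<partial>P) =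
        (\<integral>\<^sup>+\<omega>. (\<Sum>I\<in>Pow ?J. factorial_count I A ?U (\<Theta> t \<omega>) * factorial_count (?J - I) A ?U (?\<xi> \<omega>)) \<partial>P)"
      by (intro nn_integral_cong rect A)
    also have "\<dots> = (\<Sum>I\<in>Pow ?J. \<integral>\<^sup>+\<omega>. factorial_count I A ?U (\<Theta> t \<omega>) * factorial_count (?J - I) A ?U (?\<xi> \<omega>) \<partial>P)"
      by (intro nn_integral_sum borel_measurable_times_ennreal
          measurable_compose[OF \<Theta>_meas cm] measurable_compose[OF \<xi>_meas cm]) auto
    also have "\<dots> = (\<Sum>I\<in>Pow ?J. (\<Prod>j\<in>I. emeasure \<mu> (A j)) *
        inj_sum (?J - I) xs (\<lambda>j u. \<integral>\<^sup>+z\<in>A j. ennreal (p t z u) \<partial>unit_lebesgue))"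
    proof (intro sum.cong refl)
      fix I assume "I \<in> Pow ?J"
      then have I: "I \<subseteq> ?J" "finite I" using finite_subset[of I ?J] by auto
      \<comment> \<open>Both factors are measurable functions of the configurations and inherit
        their independence.\<close>
      have "indep_var borel ((factorial_count (?J - I) A ?U :: _ \<Rightarrow> ennreal) \<circ> ?\<xi>)
          borel ((factorial_count I A ?U :: _ \<Rightarrow> ennreal) \<circ> \<Theta> t)"
        by (intro indep_var_compose[OF indep] cm I Diff_subset)
      from indep_var_nn_integral[OF this]
      have "(\<integral>\<^sup>+\<omega>. factorial_count I A ?U (\<Theta> t \<omega>) * factorial_count (?J - I) A ?U (?\<xi> \<omega>) \<partial>P) =
          (\<integral>\<^sup>+\<omega>. factorial_count I A ?U (\<Theta> t \<omega>) \<partial>P) * (\<integral>\<^sup>+\<omega>. factorial_count (?J - I) A ?U (?\<xi> \<omega>) \<partial>P)"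
        by (simp only: comp_def mult.commute)
      also have "(\<integral>\<^sup>+\<omega>. factorial_count I A ?U (\<Theta> t \<omega>) \<partial>P) = (\<Prod>j\<in>I. emeasure \<mu> (A j))"
      proof (rule poisson_point_process_factorial_count[OF prob_space_axioms pois I(2), unfolded space_\<mu> sets_\<mu>])
        show "A j \<in> sets unit_lebesgue" if "j \<in> I" for j
          using that I(1) by (intro A) blast
      qed (auto simp: sets_unit_lebesgue)
      \<comment> \<open>Counts are turned back into a list, since independence of the particles is a
        statement about labelled paths.\<close>
      also have "(\<integral>\<^sup>+\<omega>. factorial_count (?J - I) A ?U (?\<xi> \<omega>) \<partial>P) =
          (\<integral>\<^sup>+\<omega>. inj_sum (?J - I) ?ks (\<lambda>j k. indicator (A j) (?X k \<omega>)) \<partial>P)"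
      proof (rule nn_integral_cong)
        fix \<omega>
        have "factorial_count (?J - I) A ?U (?\<xi> \<omega>) =
            (inj_sum (?J - I) (map (\<lambda>i. W i \<omega> t) ?ks) (\<lambda>j. indicator (A j)) :: ennreal)"
          unfolding particle_config_def mset_map_upt[symmetric]
          using A by (intro inj_sum_indicator[symmetric]) (auto simp: sets_unit_lebesgue)
        then show "factorial_count (?J - I) A ?U (?\<xi> \<omega>) =
            (inj_sum (?J - I) ?ks (\<lambda>j k. indicator (A j) (?X k \<omega>)) :: ennreal)"
          by (simp only: inj_sum_map)
      qed
      also have "\<dots> = inj_sum (?J - I) ?ks (\<lambda>j k. \<integral>\<^sup>+\<omega>. indicator (A j) (?X k \<omega>) \<partial>P)"
        using A by (intro expectation_inj_sum[OF indep_X] borel_measurable_indicator)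
          (auto simp: sets_unit_lebesgue)
      also have "\<dots> = inj_sum (?J - I) xs (\<lambda>j u. \<integral>\<^sup>+z\<in>A j. ennreal (p t z u) \<partial>unit_lebesgue)"
        unfolding xs_def inj_sum_map using A by (intro inj_sum_cong law) (simp_all only: ks, simp)
      finally show "(\<integral>\<^sup>+\<omega>. factorial_count I A ?U (\<Theta> t \<omega>) * factorial_count (?J - I) A ?U (?\<xi> \<omega>) \<partial>P) =
          (\<Prod>j\<in>I. emeasure \<mu> (A j)) *
          inj_sum (?J - I) xs (\<lambda>j u. \<integral>\<^sup>+z\<in>A j. ennreal (p t z u) \<partial>unit_lebesgue)" .
    qed
    also have "\<dots> = emeasure (density ?R (\<lambda>z. ennreal (D z))) (PiE ?J A)"
      by (rule density_rect[OF A, symmetric])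
    finally show ?thesis .
  qed

  \<comment> \<open>Identification of the two measures\<close>
  have eq: "factorial_moment_measure P n (H t) = density ?R (\<lambda>z. ennreal (D z))"
  proof (rule factorial_moment_measure_eqI[OF H_sub _ _ moment_rect])
    fix A assume A: "\<And>j. j \<in> ?J \<Longrightarrow> A j \<in> sets unit_lebesgue"
    note cm = count_meas[OF _ A]
    have "(\<lambda>\<omega>. \<Sum>I\<in>Pow ?J. factorial_count I A ?U (\<Theta> t \<omega>) * factorial_count (?J - I) A ?U (?\<xi> \<omega>) :: ennreal)
        \<in> borel_measurable P"
      by (intro borel_measurable_sum borel_measurable_times_ennreal
          measurable_compose[OF \<Theta>_meas cm] measurable_compose[OF \<xi>_meas cm]) auto
    then show "(\<lambda>\<omega>. emeasure (factorial_measure n (H t \<omega>)) (PiE ?J A)) \<in> borel_measurable P"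
      by (rule measurable_cong[THEN iffD2, rotated]) (rule rect[OF _ A])
  next
    have U: "?U \<in> sets unit_lebesgue" by (simp add: sets_unit_lebesgue)
    \<comment> \<open>This integral is the probability that the particle is still inside at time
      \<open>t\<close>, hence at most 1.\<close>
    have "(\<integral>\<^sup>+z\<in>?U. ennreal (p t z u) \<partial>unit_lebesgue) \<noteq> \<top>" if u: "u \<in> set xs" for u
    proof -
      obtain k where k: "k \<in> {1..N}" "u = x k"
        using u unfolding xs_def set_map ks by blast
      have "(\<integral>\<^sup>+\<omega>. indicator ?U (?X k \<omega>) \<partial>P) \<le> (\<integral>\<^sup>+\<omega>. 1 \<partial>P)"
        by (intro nn_integral_mono) (simp add: indicator_def)
      also have "\<dots> = 1" by (simp add: emeasure_space_1)
      finally have "(\<integral>\<^sup>+z\<in>?U. ennreal (p t z u) \<partial>unit_lebesgue) \<le> 1"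
        unfolding k(2) law[OF k(1) U] .
      then show ?thesis by (auto simp: top_unique)
    qed
    then have "inj_sum (?J - I) xs (\<lambda>j u. \<integral>\<^sup>+z\<in>?U. ennreal (p t z u) \<partial>unit_lebesgue) \<noteq> \<top>" for I
      by (intro inj_sum_neq_top) simp_all
    moreover have "(\<Prod>j\<in>I. emeasure \<mu> ?U) \<noteq> \<top>" for I :: "nat set"
      using \<mu>_fin by (simp add: ennreal_prod_eq_top del: prod_constant)
    ultimately have "(\<Sum>I\<in>Pow ?J. (\<Prod>j\<in>I. emeasure \<mu> ?U) *
        inj_sum (?J - I) xs (\<lambda>j u. \<integral>\<^sup>+z\<in>?U. ennreal (p t z u) \<partial>unit_lebesgue)) \<noteq> \<top>"
      by (simp add: ennreal_mult_eq_top_iff del: prod_constant)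
    then show "emeasure (density ?R (\<lambda>z. ennreal (D z))) (space (density ?R (\<lambda>z. ennreal (D z)))) \<noteq> \<infinity>"
      unfolding space_density space_R using density_rect[of "\<lambda>_. ?U", OF U] by simp
  qed simp_all
  show ?thesis
    using D_meas absolutely_continuousI_density[of "\<lambda>z. ennreal (D z)" ?R] eq
    unfolding D_def by simp
qed

end
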